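(* Let $M5$ be the real Lie algebra with basis $x_1,\dots,x_6$ and nonzero brackets $[x_1,x_3]=x_5$, $[x_1,x_4]=x_6$, $[x_2,x_3]=-x_6$, $[x_2,x_4]=x_5$ (the realification of the 3-dimensional complex Heisenberg Lie algebra). The set $\mathfrak{X}_{M5}$ of all complex structures on $M5$ is a 12-dimensional submanifold of $\mathbb{R}^{36}$.
   Context: Brackets of basis vectors not listed (and not obtained by antisymmetry) are zero. A complex structure on a real Lie algebra $\mathfrak{g}$ is a linear map $J:\mathfrak{g}\to\mathfrak{g}$ with $J^2=-1$ and $[JX,JY]-[X,Y]-J[JX,Y]-J[X,JY]=0$ for all $X,Y\in\mathfrak{g}$ (here $J$ is not required to be complex-linear for any structure on $M5$). $J$ is identified with its $6\times 6$ matrix in the basis $(x_j)$; so the set of complex structures is a subset of $\mathbb{R}^{36}$. "Submanifold" means smooth ($C^\infty$) submanifold. *)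

theory Defs
  imports "HOL-Analysis.Analysis"
begin

text \<open>Vectors are columns indexed by the numeral type \<open>6\<close>; in that type \<open>6 = 0\<close>, so
  \<open>1, \<dots>, 6\<close> are its six distinct elements and \<open>axis j 1\<close> is the basis vector $x_j$.
  The components below are the bilinear, antisymmetric extension of the bracket table, which is
  recovered in \<open>M5_bracket_table\<close> and \<open>M5_bracket_table_zero\<close>.\<close>

definition M5_bracket :: "real^6 \<Rightarrow> real^6 \<Rightarrow> real^6" where
  "M5_bracket X Y = (\<chi> k.
     if k = 5 then (X$1 * Y$3 - X$3 * Y$1) + (X$2 * Y$4 - X$4 * Y$2)
     else if k = 6 then (X$1 * Y$4 - X$4 * Y$1) - (X$2 * Y$3 - X$3 * Y$2)
     else 0)"

lemma UNIV_6: "(UNIV :: 6 set) = {1, 2, 3, 4, 5, 6}"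
proof -
  have "card {1, 2, 3, 4, 5, 6 :: 6} = card (UNIV :: 6 set)"
    by simp
  then show ?thesis
    by (metis card_subset_eq finite subset_UNIV)
qed

lemma M5_bracket_bilinear: "bilinear M5_bracket"
  unfolding bilinear_def
  by (auto intro!: linearI simp: M5_bracket_def vec_eq_iff algebra_simps)

lemma M5_bracket_antisym: "M5_bracket X Y = - M5_bracket Y X"
  by (simp add: M5_bracket_def vec_eq_iff)

lemma M5_bracket_jacobi:
  "M5_bracket X (M5_bracket Y Z) + M5_bracket Y (M5_bracket Z X) + M5_bracket Z (M5_bracket X Y) = 0"
  by (simp add: M5_bracket_def vec_eq_iff)

lemma M5_bracket_table:
  "M5_bracket (axis 1 1) (axis 3 1) = axis 5 1"
  "M5_bracket (axis 1 1) (axis 4 1) = axis 6 1"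
  "M5_bracket (axis 2 1) (axis 3 1) = - axis 6 1"
  "M5_bracket (axis 2 1) (axis 4 1) = axis 5 1"
  by (auto simp: M5_bracket_def vec_eq_iff axis_def)

lemma M5_bracket_table_zero:
  assumes "(i, j) \<notin> {(1,3), (1,4), (2,3), (2,4), (3,1), (4,1), (3,2), (4,2)}"
  shows "M5_bracket (axis i 1) (axis j 1) = 0"
  using assms by (auto simp: M5_bracket_def vec_eq_iff axis_def)

definition complex_structure ::
    "('a::real_vector \<Rightarrow> 'a \<Rightarrow> 'a) \<Rightarrow> ('a \<Rightarrow> 'a) \<Rightarrow> bool" where
  "complex_structure br J \<longleftrightarrow>
     linear J \<and>
     (\<forall>X. J (J X) = - X) \<and>
     (\<forall>X Y. br (J X) (J Y) - br X Y - J (br (J X) Y) - J (br X (J Y)) = 0)"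

definition complex_structures_M5 :: "(real^6^6) set" where
  "complex_structures_M5 = {matrix J |J. complex_structure M5_bracket J}"

lemma DIM_matrix_6: "DIM(real^6^6) = 36"
  by simp

text \<open>\<open>Ck_on k U f\<close> is meant for open \<open>U\<close>: all iterated directional derivatives of \<open>f\<close> of order
  up to \<open>k\<close> exist on \<open>U\<close> and are continuous.\<close>

primrec Ck_on ::
    "nat \<Rightarrow> 'a::real_normed_vector set \<Rightarrow> ('a \<Rightarrow> 'b::real_normed_vector) \<Rightarrow> bool" where
  "Ck_on 0 U f \<longleftrightarrow> continuous_on U f"
| "Ck_on (Suc k) U f \<longleftrightarrow>
     (\<forall>x\<in>U. f differentiable (at x)) \<and>
     (\<forall>v. Ck_on k U (\<lambda>x. frechet_derivative f (at x) v))"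

definition smooth_on ::
    "'a::real_normed_vector set \<Rightarrow> ('a \<Rightarrow> 'b::real_normed_vector) \<Rightarrow> bool" where
  "smooth_on U f \<longleftrightarrow> (\<forall>k. Ck_on k U f)"

definition smooth_diffeomorphism ::
    "'a::real_normed_vector set \<Rightarrow> 'b::real_normed_vector set \<Rightarrow> ('a \<Rightarrow> 'b) \<Rightarrow> ('b \<Rightarrow> 'a) \<Rightarrow> bool" where
  "smooth_diffeomorphism U V \<phi> \<psi> \<longleftrightarrow>
     open U \<and> open V \<and> homeomorphism U V \<phi> \<psi> \<and> smooth_on U \<phi> \<and> smooth_on V \<psi>"

text \<open>Embedded submanifolds, by slice charts of the ambient space; the dimension is \<open>d\<close> at
  every point.\<close>

definition smooth_submanifold :: "nat \<Rightarrow> 'a::euclidean_space set \<Rightarrow> bool" where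
  "smooth_submanifold d M \<longleftrightarrow>
     (\<forall>p\<in>M. \<exists>U (V :: 'a set) \<phi> \<psi> S.
        p \<in> U \<and> smooth_diffeomorphism U V \<phi> \<psi> \<and>
        subspace S \<and> dim S = d \<and> \<phi> ` (U \<inter> M) = V \<inter> S)"

end

(* Identify M5 with C^3 so that the bracket is ((a,b,c),(a',b',c')) |-> (0,0,ab'-a'b), and let I be
   multiplication by i, possibly with the second factor C conjugated. For fixed I, the Cayley
   transform J |-> K with 1 + K = 2 (J+I)^{-1} I is a rational diffeomorphism of open sets of
   6x6 matrices. It takes J^2 = -1 to KI = -IK; every complex structure preserves the centre, so
   K is a conjugate-linear map given by seven complex parameters, and integrability of J becomes
   one polynomial equation in them that expresses one parameter through the other six. Thus the
   complex structures with J+I invertible form, in the K-chart, the graph of a polynomial map over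
   a real subspace of dimension 12, and a shear straightens the graph.

   It remains to see that these charts suffice up to the symmetries J |-> -J and conjugation by
   automorphisms of M5. If neither J+I nor -J+I is invertible for the standard I, then J acts on
   the quotient C^2 by the centre as diag(i,-i) in some complex basis; an automorphism moves this
   basis to the standard one, and the conjugated I applies. *)
theory Submission
  imports Defs
begin

section \<open>Smooth maps\<close>

text \<open>On an open set the values of a function near a point determine its derivative there, so
  agreement on \<open>U\<close> passes to all directional derivatives and the induction on
  \<open>k\<close> goes through.\<close>

lemma Ck_on_cong:
  assumes "open U" "\<And>x. x \<in> U \<Longrightarrow> f x = g x" "Ck_on k U f"
  shows "Ck_on k U g"
  using assms(2,3)
proof (induction k arbitrary: f g)
  case 0
  then show ?case using continuous_on_cong[of U U f g] by simp
next
  case (Suc k)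
  have der: "(g has_derivative frechet_derivative f (at x)) (at x)" if "x \<in> U" for x
    using Suc.prems that assms(1)
    by (intro has_derivative_transform_within_open[of f _ x UNIV U g])
       (auto simp: frechet_derivative_works[symmetric])
  have eq: "frechet_derivative f (at x) v = frechet_derivative g (at x) v" if "x \<in> U" for x v
    using frechet_derivative_at[OF der[OF that]] by simp
  have "Ck_on k U (\<lambda>x. frechet_derivative f (at x) v)" for v
    using Suc.prems(2) unfolding Ck_on.simps by blast
  then have "Ck_on k U (\<lambda>x. frechet_derivative g (at x) v)" for v
    by (rule Suc.IH[of "\<lambda>x. frechet_derivative f (at x) v", rotated]) (rule eq)
  then show ?case
    unfolding Ck_on.simps using der differentiableI by blast
qed

text \<open>Allows a derivative written as an explicit formula \<open>f'\<close> in place of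
  \<open>frechet_derivative\<close>; the calculus rules below are inductions through it.\<close>

lemma Ck_on_SucI:
  assumes "open U" "\<And>x. x \<in> U \<Longrightarrow> (f has_derivative f' x) (at x)"
    "\<And>v. Ck_on k U (\<lambda>x. f' x v)"
  shows "Ck_on (Suc k) U f"
proof -
  have eq: "f' x v = frechet_derivative f (at x) v" if "x \<in> U" for x v
    using frechet_derivative_at[OF assms(2)[OF that]] by simp
  have "Ck_on k U (\<lambda>x. frechet_derivative f (at x) v)" for v
    by (rule Ck_on_cong[OF assms(1) _ assms(3)[of v]]) (rule eq)
  then show ?thesis
    unfolding Ck_on.simps using assms(2) differentiableI by blast
qed

lemma Ck_on_Suc_has_derivative:
  "Ck_on (Suc k) U f \<Longrightarrow> x \<in> U \<Longrightarrow> (f has_derivative frechet_derivative f (at x)) (at x)"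
  by (simp add: frechet_derivative_works[symmetric])

lemma Ck_on_SucD: "Ck_on (Suc k) U f \<Longrightarrow> Ck_on k U f"
proof (induction k arbitrary: f)
  case 0
  then have "f differentiable (at x)" if "x \<in> U" for x
    using that by simp
  then show ?case
    by (simp add: continuous_at_imp_continuous_on differentiable_imp_continuous_within)
next
  case (Suc k)
  show ?case
    unfolding Ck_on.simps(2)[of k]
  proof (intro conjI allI)
    show "\<forall>x\<in>U. f differentiable (at x)"
      using Suc.prems unfolding Ck_on.simps(2)[of "Suc k"] by blast
    show "Ck_on k U (\<lambda>x. frechet_derivative f (at x) v)" for v
      by (rule Suc.IH) (use Suc.prems in \<open>unfold Ck_on.simps(2)[of "Suc k"], blast\<close>)
  qed
qed

lemma Ck_on_const: "Ck_on k U (\<lambda>x. c)"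
proof (induction k arbitrary: c)
  case (Suc k)
  then show ?case by simp
qed simp

lemma Ck_on_id: "open U \<Longrightarrow> Ck_on k U (\<lambda>x. x)"
proof (cases k)
  case (Suc m)
  then show ?thesis by (simp add: Ck_on_const)
qed simp

lemma Ck_on_bounded_linear:
  assumes "bounded_linear L" "open U" "Ck_on k U f"
  shows "Ck_on k U (\<lambda>x. L (f x))"
  using assms(3)
proof (induction k arbitrary: f)
  case 0
  then show ?case using bounded_linear.continuous_on[OF assms(1)] by simp
next
  case (Suc k)
  show ?case
  proof (rule Ck_on_SucI[OF assms(2)])
    show "((\<lambda>x. L (f x)) has_derivative (\<lambda>v. L (frechet_derivative f (at x) v))) (at x)"
      if "x \<in> U" for x
      by (rule bounded_linear.has_derivative[OF assms(1) Ck_on_Suc_has_derivative[OF Suc.prems that]])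
    show "Ck_on k U (\<lambda>x. L (frechet_derivative f (at x) v))" for v
      using Suc by simp
  qed
qed

lemma Ck_on_add:
  assumes "open U" "Ck_on k U f" "Ck_on k U g"
  shows "Ck_on k U (\<lambda>x. f x + g x)"
  using assms(2,3)
proof (induction k arbitrary: f g)
  case 0
  then show ?case unfolding Ck_on.simps by (rule continuous_on_add)
next
  case (Suc k)
  show ?case
  proof (rule Ck_on_SucI[OF assms(1)])
    show "((\<lambda>x. f x + g x) has_derivative
        (\<lambda>v. frechet_derivative f (at x) v + frechet_derivative g (at x) v)) (at x)"
      if "x \<in> U" for x
      by (rule has_derivative_add[OF Suc.prems[THEN Ck_on_Suc_has_derivative, OF that]])
    show "Ck_on k U (\<lambda>x. frechet_derivative f (at x) v + frechet_derivative g (at x) v)" for v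
      by (rule Suc.IH) (use Suc.prems in simp_all)
  qed
qed

text \<open>By the product rule the derivative is a sum of two terms of the same bilinear shape.
  Each pairs a derivative with an undifferentiated factor, and \<open>Ck_on_SucD\<close> lowers the
  order of the latter to fit the induction hypothesis.\<close>

lemma Ck_on_bilinear:
  assumes "bounded_bilinear h" "open U" "Ck_on k U f" "Ck_on k U g"
  shows "Ck_on k U (\<lambda>x. h (f x) (g x))"
  using assms(3,4)
proof (induction k arbitrary: f g)
  case 0
  show ?case
    unfolding Ck_on.simps
    by (rule bounded_bilinear.continuous_on[OF assms(1) "0"[unfolded Ck_on.simps]])
next
  case (Suc k)
  show ?case
  proof (rule Ck_on_SucI[OF assms(2)])
    show "((\<lambda>x. h (f x) (g x)) has_derivative
        (\<lambda>v. h (f x) (frechet_derivative g (at x) v)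
            + h (frechet_derivative f (at x) v) (g x))) (at x)"
      if "x \<in> U" for x
      by (rule bounded_bilinear.FDERIV[OF assms(1) Suc.prems[THEN Ck_on_Suc_has_derivative, OF that]])
    show "Ck_on k U
        (\<lambda>x. h (f x) (frechet_derivative g (at x) v) + h (frechet_derivative f (at x) v) (g x))" for v
      by (rule Ck_on_add[OF assms(2)]; rule Suc.IH)
        (use Suc.prems Suc.prems[THEN Ck_on_SucD] in simp_all)
  qed
qed

text \<open>The derivative of \<open>1/f\<close> is \<open>-(1/f) f' (1/f)\<close>, a product of
  functions of class \<open>k\<close>, where \<open>1/f\<close> itself is covered by the induction
  hypothesis.\<close>

lemma Ck_on_inverse:
  fixes f :: "'a::real_normed_vector \<Rightarrow> 'b::real_normed_field"
  assumes "open U" "\<And>x. x \<in> U \<Longrightarrow> f x \<noteq> 0" "Ck_on k U f"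
  shows "Ck_on k U (\<lambda>x. inverse (f x))"
  using assms(3)
proof (induction k)
  case 0
  then show ?case using assms(2) unfolding Ck_on.simps by (blast intro: continuous_on_inverse)
next
  case (Suc k)
  note inv = Suc.IH[OF Ck_on_SucD[OF Suc.prems]]
  show ?case
  proof (rule Ck_on_SucI[OF assms(1)])
    show "((\<lambda>x. inverse (f x)) has_derivative
        (\<lambda>v. - (inverse (f x) * frechet_derivative f (at x) v * inverse (f x)))) (at x)"
      if "x \<in> U" for x
      by (rule Deriv.has_derivative_inverse[OF assms(2)[OF that] Ck_on_Suc_has_derivative[OF
          Suc.prems that]])
    show "Ck_on k U (\<lambda>x. - (inverse (f x) * frechet_derivative f (at x) v * inverse (f x)))" for v
      by (intro Ck_on_bounded_linear[OF bounded_linear_minus[OF bounded_linear_ident]]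
            Ck_on_bilinear[OF bounded_bilinear_mult] assms(1) inv)
        (use Suc.prems in simp)
  qed
qed

text \<open>With a linear inner map the chain rule again yields a function composed with the same
  \<open>L\<close>, so the induction closes. This is the case needed to pull charts back along
  linear symmetries.\<close>

lemma Ck_on_compose_linear:
  assumes "bounded_linear L" "open U" "Ck_on k U f"
  shows "Ck_on k (L -` U) (\<lambda>x. f (L x))"
  using assms(3)
proof (induction k arbitrary: f)
  case 0
  have "continuous_on (L -` U) L"
    using assms(1) by (rule linear_continuous_on)
  then show ?case using 0 by (auto intro: continuous_on_compose2)
next
  case (Suc k)
  have op: "open (L -` U)"
    using assms(1,2) by (simp add: linear_continuous_on open_vimage)
  show ?case
  proof (rule Ck_on_SucI[OF op])
    show "((\<lambda>x. f (L x)) has_derivative (\<lambda>v. frechet_derivative f (at (L x)) (L v))) (at x)"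
      if "x \<in> L -` U" for x
      using has_derivative_compose[OF bounded_linear_imp_has_derivative[OF assms(1)]
          Ck_on_Suc_has_derivative[OF Suc.prems]] that by simp
    show "Ck_on k (L -` U) (\<lambda>x. frechet_derivative f (at (L x)) (L v))" for v
      using Suc.IH[of "\<lambda>y. frechet_derivative f (at y) (L v)"] Suc.prems by simp
  qed
qed

lemma smooth_on_const: "smooth_on U (\<lambda>x. c)"
  by (simp add: smooth_on_def Ck_on_const)

lemma smooth_on_id: "open U \<Longrightarrow> smooth_on U (\<lambda>x. x)"
  by (simp add: smooth_on_def Ck_on_id)

lemma smooth_on_bounded_linear:
  "bounded_linear L \<Longrightarrow> open U \<Longrightarrow> smooth_on U f \<Longrightarrow> smooth_on U (\<lambda>x. L (f x))"
  by (simp add: smooth_on_def Ck_on_bounded_linear)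

lemma smooth_on_linear:
  fixes L :: "'a::euclidean_space \<Rightarrow> 'b::real_normed_vector"
  shows "linear L \<Longrightarrow> open U \<Longrightarrow> smooth_on U f \<Longrightarrow> smooth_on U (\<lambda>x. L (f x))"
  by (simp add: smooth_on_bounded_linear linear_conv_bounded_linear)

lemma smooth_on_add:
  "open U \<Longrightarrow> smooth_on U f \<Longrightarrow> smooth_on U g \<Longrightarrow> smooth_on U (\<lambda>x. f x + g x)"
  by (simp add: smooth_on_def Ck_on_add)

lemma smooth_on_diff:
  assumes "open U" "smooth_on U f" "smooth_on U g"
  shows "smooth_on U (\<lambda>x. f x - g x)"
  using smooth_on_add[OF assms(1,2) smooth_on_bounded_linear[OF bounded_linear_minus[OF
      bounded_linear_ident] assms(1,3)]]
  by simp

lemma smooth_on_sum: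
  "open U \<Longrightarrow> (\<And>i. i \<in> I \<Longrightarrow> smooth_on U (f i)) \<Longrightarrow> smooth_on U (\<lambda>x. \<Sum>i\<in>I. f i x)"
  by (induction I rule: infinite_finite_induct) (simp_all add: smooth_on_add smooth_on_const)

lemma smooth_on_bilinear:
  "bounded_bilinear h \<Longrightarrow> open U \<Longrightarrow> smooth_on U f \<Longrightarrow> smooth_on U g \<Longrightarrow>
    smooth_on U (\<lambda>x. h (f x) (g x))"
  by (simp add: smooth_on_def Ck_on_bilinear)

lemmas smooth_on_mult = smooth_on_bilinear[OF bounded_bilinear_mult]

lemma smooth_on_prod:
  fixes f :: "'i \<Rightarrow> 'a::real_normed_vector \<Rightarrow> 'b::{real_normed_algebra, comm_ring_1}"
  shows "open U \<Longrightarrow> (\<And>i. i \<in> I \<Longrightarrow> smooth_on U (f i)) \<Longrightarrow> smooth_on U (\<lambda>x. \<Prod>i\<in>I. f i x)"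
  by (induction I rule: infinite_finite_induct) (simp_all add: smooth_on_mult smooth_on_const)

lemma smooth_on_inverse:
  fixes f :: "'a::real_normed_vector \<Rightarrow> 'b::real_normed_field"
  shows "open U \<Longrightarrow> (\<And>x. x \<in> U \<Longrightarrow> f x \<noteq> 0) \<Longrightarrow> smooth_on U f \<Longrightarrow> smooth_on U (\<lambda>x. inverse (f x))"
  by (simp add: smooth_on_def Ck_on_inverse)

lemma smooth_on_compose_linear:
  "bounded_linear L \<Longrightarrow> open U \<Longrightarrow> smooth_on U f \<Longrightarrow> smooth_on (L -` U) (\<lambda>x. f (L x))"
  by (simp add: smooth_on_def Ck_on_compose_linear)

lemma smooth_on_cong:
  "open U \<Longrightarrow> (\<And>x. x \<in> U \<Longrightarrow> f x = g x) \<Longrightarrow> smooth_on U f \<Longrightarrow> smooth_on U g"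
  unfolding smooth_on_def using Ck_on_cong by blast

lemma smooth_on_componentwise:
  fixes f :: "'a::real_normed_vector \<Rightarrow> 'b::euclidean_space"
  assumes "open U" "\<And>b. b \<in> Basis \<Longrightarrow> smooth_on U (\<lambda>x. f x \<bullet> b)"
  shows "smooth_on U f"
proof -
  have "smooth_on U (\<lambda>x. \<Sum>b\<in>Basis. (f x \<bullet> b) *\<^sub>R b)"
    using assms by (intro smooth_on_sum smooth_on_bounded_linear[OF bounded_linear_scaleR_left])
  then show ?thesis by (simp add: euclidean_representation)
qed

lemma smooth_on_matrix:
  fixes A :: "'a::real_normed_vector \<Rightarrow> real^'n^'m"
  assumes "open U" "\<And>i j. smooth_on U (\<lambda>x. A x $ i $ j)"
  shows "smooth_on U A"
  by (rule smooth_on_componentwise) (use assms in \<open>auto simp: Basis_vec_def inner_axis\<close>)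

lemma smooth_on_det:
  fixes A :: "'a::real_normed_vector \<Rightarrow> real^'n^'n"
  assumes "open U" "\<And>i j. smooth_on U (\<lambda>x. A x $ i $ j)"
  shows "smooth_on U (\<lambda>x. det (A x))"
  unfolding det_def using assms
  by (intro smooth_on_sum smooth_on_mult smooth_on_prod smooth_on_const) auto

section \<open>Matrix inversion and the open set of invertible matrices\<close>

lemma
  fixes A :: "'a::semiring_1^'n^'m"
  assumes "invertible A"
  shows matrix_inv_right: "A ** matrix_inv A = mat 1"
    and matrix_inv_left: "matrix_inv A ** A = mat 1"
  using someI_ex[OF assms[unfolded invertible_def]] by (simp_all add: matrix_inv_def)

text \<open>By Cramer's rule each entry of the inverse is a quotient of two determinants, hence a
  rational function of the entries of \<open>A x\<close> with nonvanishing denominator.\<close>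

lemma smooth_on_matrix_inv:
  fixes A :: "'a::real_normed_vector \<Rightarrow> real^'n^'n"
  assumes "open U" "smooth_on U A" "\<And>x. x \<in> U \<Longrightarrow> invertible (A x)"
  shows "smooth_on U (\<lambda>x. matrix_inv (A x))"
proof (rule smooth_on_matrix[OF assms(1)])
  fix i j
  have A: "smooth_on U (\<lambda>x. A x $ k $ l)" for k l
    by (rule smooth_on_bounded_linear[OF
          bounded_linear_compose[OF bounded_linear_vec_nth bounded_linear_vec_nth] assms(1,2)])
  \<comment> \<open>\<open>C x\<close> is \<open>A x\<close> with column \<open>i\<close> replaced
    by the \<open>j\<close>-th unit vector, the numerator in Cramer's rule for entry
    \<open>(i, j)\<close> of the inverse.\<close>
  define C where "C x = (\<chi> k l. if l = i then axis j 1 $ k else A x $ k $ l)" for x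
  have "smooth_on U (\<lambda>x. C x $ k $ l)" for k l
    unfolding C_def using A smooth_on_const by (cases "l = i") auto
  then have smooth: "smooth_on U (\<lambda>x. det (C x) * inverse (det (A x)))"
    using assms(1,3) A
    by (intro smooth_on_mult smooth_on_inverse smooth_on_det) (auto simp: invertible_det_nz)
  have eq: "det (C x) * inverse (det (A x)) = matrix_inv (A x) $ i $ j" if "x \<in> U" for x
  proof -
    have inv: "invertible (A x)" using assms(3) that by simp
    have "A x *v (matrix_inv (A x) *v axis j 1) = axis j 1"
      using inv by (simp add: matrix_vector_mul_assoc matrix_inv_right)
    then have "matrix_inv (A x) *v axis j 1 = (\<chi> k. det (\<chi> m l. if l
        = k then axis j 1 $ m else A x $ m $ l) / det (A x))"
      using cramer[of "A x"] inv by (auto simp: invertible_det_nz)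
    then have "(matrix_inv (A x) *v axis j 1) $ i = det (C x) / det (A x)"
      by (simp add: C_def)
    then show ?thesis by (simp add: matrix_vector_mult_basis column_def divide_inverse)
  qed
  show "smooth_on U (\<lambda>x. matrix_inv (A x) $ i $ j)"
    by (rule smooth_on_cong[OF assms(1) _ smooth]) (rule eq)
qed

lemma matrix_inv_unique:
  fixes A :: "'a::field^'n^'n"
  assumes "A ** B = mat 1"
  shows "invertible A" "matrix_inv A = B"
proof -
  show inv: "invertible A"
    using assms invertible_right_inverse by blast
  have "matrix_inv A ** (A ** B) = B"
    by (simp add: matrix_mul_assoc matrix_inv_left[OF inv])
  then show "matrix_inv A = B"
    by (simp add: assms)
qed

lemma bounded_bilinear_matrix_mult:
  "bounded_bilinear ((**) :: real^'n^'m \<Rightarrow> real^'k^'n \<Rightarrow> real^'k^'m)"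
  unfolding bilinear_conv_bounded_bilinear[symmetric] bilinear_def
  by (auto intro!: linearI simp: vec_eq_iff matrix_matrix_mult_def algebra_simps sum.distrib
      sum_distrib_left)

lemmas matrix_mult_linear =
  bounded_bilinear.scaleR_left[OF bounded_bilinear_matrix_mult]
  bounded_bilinear.scaleR_right[OF bounded_bilinear_matrix_mult]
  bounded_bilinear.minus_left[OF bounded_bilinear_matrix_mult]
  bounded_bilinear.minus_right[OF bounded_bilinear_matrix_mult]

lemma open_invertible:
  fixes A :: "'a::real_normed_vector \<Rightarrow> real^'n^'n"
  assumes "smooth_on UNIV A"
  shows "open {x. invertible (A x)}"
proof -
  have "smooth_on UNIV (\<lambda>x. A x $ i $ j)" for i j
    by (rule smooth_on_bounded_linear[OF
          bounded_linear_compose[OF bounded_linear_vec_nth bounded_linear_vec_nth] open_UNIV assms])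
  then have "Ck_on 0 UNIV (\<lambda>x. det (A x))"
    using smooth_on_det[OF open_UNIV] unfolding smooth_on_def by blast
  then have "continuous_on UNIV (\<lambda>x. det (A x))"
    by simp
  then have "open ((\<lambda>x. det (A x)) -` (- {0}))"
    by (intro open_vimage) auto
  then show ?thesis
    by (simp add: vimage_def invertible_det_nz)
qed

section \<open>Slice charts from the Cayley transform\<close>

text \<open>The condition of \<open>smooth_submanifold\<close> at a single point, isolated so that
  charts can be built and transported one point at a time.\<close>

definition slice_chart_at :: "nat \<Rightarrow> 'a::euclidean_space set \<Rightarrow> 'a \<Rightarrow> bool" where
  "slice_chart_at d M p \<longleftrightarrow>
     (\<exists>U (V :: 'a set) \<phi> \<psi> S.
        p \<in> U \<and> smooth_diffeomorphism U V \<phi> \<psi> \<and>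
        subspace S \<and> dim S = d \<and> \<phi> ` (U \<inter> M) = V \<inter> S)"

lemma smooth_submanifold_iff: "smooth_submanifold d M \<longleftrightarrow> (\<forall>p\<in>M. slice_chart_at d M p)"
  by (simp add: smooth_submanifold_def slice_chart_at_def)

lemma smooth_diffeomorphismI:
  assumes "open U" "open V" "smooth_on U \<phi>" "smooth_on V \<psi>"
    "\<And>x. x \<in> U \<Longrightarrow> \<phi> x \<in> V" "\<And>y. y \<in> V \<Longrightarrow> \<psi> y \<in> U"
    "\<And>x. x \<in> U \<Longrightarrow> \<psi> (\<phi> x) = x" "\<And>y. y \<in> V \<Longrightarrow> \<phi> (\<psi> y) = y"
  shows "smooth_diffeomorphism U V \<phi> \<psi>"
proof -
  have "Ck_on 0 U \<phi>" "Ck_on 0 V \<psi>"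
    using assms(3,4) unfolding smooth_on_def by blast+
  moreover have "\<phi> ` U = V" "\<psi> ` V = U"
    using assms(5-8) by force+
  ultimately show ?thesis
    using assms unfolding smooth_diffeomorphism_def homeomorphism_def by simp
qed

text \<open>A linear automorphism \<open>L\<close> preserving \<open>M\<close> pulls a chart at
  \<open>L p\<close> back to a chart at \<open>p\<close> by precomposition; the target
  \<open>V\<close> and the slice \<open>S\<close> stay the same.\<close>

lemma slice_chart_at_linear:
  fixes L L' :: "'a::euclidean_space \<Rightarrow> 'a"
  assumes lin: "linear L" "linear L'" and inv: "\<And>x. L' (L x) = x" "\<And>x. L (L' x) = x"
    and M: "\<And>x. L x \<in> M \<longleftrightarrow> x \<in> M" and chart: "slice_chart_at d M (L p)"
  shows "slice_chart_at d M p"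
proof -
  obtain U and V :: "'a set" and \<phi> \<psi> S where
    c: "L p \<in> U" "smooth_diffeomorphism U V \<phi> \<psi>" "subspace S" "dim S = d" "\<phi> ` (U \<inter> M) = V \<inter> S"
    using chart unfolding slice_chart_at_def by blast
  have bl: "bounded_linear L" "bounded_linear L'"
    using lin by (simp_all add: linear_conv_bounded_linear)
  have o: "open U" "open V" "smooth_on U \<phi>" "smooth_on V \<psi>" and h: "homeomorphism U V \<phi> \<psi>"
    using c(2) unfolding smooth_diffeomorphism_def by auto
  have "smooth_diffeomorphism (L -` U) V (\<lambda>x. \<phi> (L x)) (\<lambda>y. L' (\<psi> y))"
  proof (rule smooth_diffeomorphismI)
    show "open (L -` U)"
      using bl(1) o(1) by (simp add: linear_continuous_on open_vimage)
    show "smooth_on (L -` U) (\<lambda>x. \<phi> (L x))"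
      by (rule smooth_on_compose_linear[OF bl(1) o(1,3)])
    show "smooth_on V (\<lambda>y. L' (\<psi> y))"
      by (rule smooth_on_bounded_linear[OF bl(2) o(2,4)])
  qed (use h inv o in \<open>auto simp: homeomorphism_def\<close>)
  moreover have "L ` (L -` U \<inter> M) = U \<inter> M"
    using M inv by (auto intro!: image_eqI[of _ L "L' _"]) (metis M inv(2))
  then have "(\<lambda>x. \<phi> (L x)) ` (L -` U \<inter> M) = V \<inter> S"
    using c(5) by (simp add: image_image[symmetric])
  ultimately show ?thesis
    unfolding slice_chart_at_def using c(1,3,4) by (metis vimageI)
qed

text \<open>In the Cayley coordinate \<open>K\<close> the set \<open>M\<close> is the graph of
  \<open>g\<close> over the range of the projection \<open>P\<close>: \<open>g\<close> depends only
  on \<open>P K\<close> and takes values in the kernel of \<open>P\<close>. The shear that subtracts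
  \<open>g\<close> flattens this graph onto \<open>range P\<close>.\<close>

lemma slice_chart_at_cayley:
  fixes J0 p :: "real^'n^'n" and P g :: "real^'n^'n \<Rightarrow> real^'n^'n"
  assumes J0: "J0 ** J0 = - mat 1" and p: "invertible (p + J0)"
    and P: "linear P" and PP: "\<And>K. P (P K) = P K" and Pg: "\<And>K. P (g K) = 0" and gP:
        "\<And>K. g (P K) = g K"
    and smooth_g: "\<And>U f. open U \<Longrightarrow> smooth_on U f \<Longrightarrow> smooth_on U (\<lambda>x :: real^'n^'n. g (f x))"
    and M: "\<And>K. invertible (mat 1 + K) \<Longrightarrow>
          2 *\<^sub>R (J0 ** matrix_inv (mat 1 + K)) - J0 \<in> M \<longleftrightarrow> K = P K + g K"
  shows "slice_chart_at (dim (range P)) M p"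
proof -
  define \<kappa> where "\<kappa> J = 2 *\<^sub>R (matrix_inv (J + J0) ** J0) - mat 1" for J
  define \<tau> where "\<tau> K = 2 *\<^sub>R (J0 ** matrix_inv (mat 1 + K)) - J0" for K
  have \<kappa>: "invertible (mat 1 + \<kappa> J)" "\<tau> (\<kappa> J) = J" if J: "invertible (J + J0)" for J
  proof -
    have eq: "mat 1 + \<kappa> J = 2 *\<^sub>R (matrix_inv (J + J0) ** J0)"
      by (simp add: \<kappa>_def)
    \<comment> \<open>Since \<open>J0\<close> has inverse \<open>- J0\<close>, the matrix
      \<open>2 (J + J0)^(-1) J0\<close> has the explicit inverse \<open>- 1/2 J0 (J + J0)\<close>;
      substituting it in \<open>\<tau>\<close> recovers \<open>J\<close>. The computation for
      \<open>\<tau>\<close> below is the mirror image.\<close>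
    have "(mat 1 + \<kappa> J) ** (- (1/2) *\<^sub>R (J0 ** (J + J0))) =
        - (matrix_inv (J + J0) ** (J0 ** J0) ** (J + J0))"
      unfolding eq by (simp add: matrix_mult_linear matrix_mul_assoc)
    also have "\<dots> = mat 1"
      by (simp add: J0 matrix_mult_linear matrix_inv_left[OF J])
    finally have i: "(mat 1 + \<kappa> J) ** (- (1/2) *\<^sub>R (J0 ** (J + J0))) = mat 1" .
    show "invertible (mat 1 + \<kappa> J)"
      using matrix_inv_unique(1)[OF i] .
    have "\<tau> (\<kappa> J) = - ((J0 ** J0) ** (J + J0)) - J0"
      unfolding \<tau>_def matrix_inv_unique(2)[OF i]
      by (simp add: matrix_mult_linear matrix_mul_assoc)
    then show "\<tau> (\<kappa> J) = J"
      by (simp add: J0 matrix_mult_linear)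
  qed
  have \<tau>: "invertible (\<tau> K + J0)" "\<kappa> (\<tau> K) = K" if K: "invertible (mat 1 + K)" for K
  proof -
    have eq: "\<tau> K + J0 = 2 *\<^sub>R (J0 ** matrix_inv (mat 1 + K))"
      by (simp add: \<tau>_def)
    have "(\<tau> K + J0) ** (- (1/2) *\<^sub>R ((mat 1 + K) ** J0)) =
        - (J0 ** (matrix_inv (mat 1 + K) ** (mat 1 + K)) ** J0)"
      unfolding eq by (simp add: matrix_mult_linear matrix_mul_assoc)
    also have "\<dots> = mat 1"
      by (simp add: J0 matrix_mult_linear matrix_inv_left[OF K])
    finally have i: "(\<tau> K + J0) ** (- (1/2) *\<^sub>R ((mat 1 + K) ** J0)) = mat 1" .
    show "invertible (\<tau> K + J0)"
      using matrix_inv_unique(1)[OF i] .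
    have "\<kappa> (\<tau> K) = - ((mat 1 + K) ** (J0 ** J0)) - mat 1"
      unfolding \<kappa>_def matrix_inv_unique(2)[OF i]
      by (simp add: matrix_mult_linear matrix_mul_assoc)
    then show "\<kappa> (\<tau> K) = K"
      by (simp add: J0 matrix_mult_linear)
  qed
  \<comment> \<open>Adding or subtracting a value of \<open>g\<close> does not change the image
    under \<open>P\<close>, hence not the value of \<open>g\<close>. So the maps
    \<open>y + g y\<close> and \<open>K - g K\<close> are mutually inverse.\<close>
  have g_shift: "g (y + g y) = g y" "g (K - g K) = g K" for y K
    using gP[of "y + g y"] gP[of "K - g K"] by (simp_all add: linear_add[OF P] linear_diff[OF P] Pg
        gP)
  define U where "U = {J. invertible (J + J0)}"
  define V where "V = {y. invertible (mat 1 + (y + g y))}"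
  have "smooth_on UNIV (\<lambda>y. mat 1 + (y + g y))"
    by (intro smooth_on_add smooth_on_const smooth_g smooth_on_id open_UNIV)
  then have oV: "open V"
    unfolding V_def by (rule open_invertible)
  have "smooth_on UNIV (\<lambda>J. J + J0)"
    by (intro smooth_on_add smooth_on_const smooth_on_id open_UNIV)
  then have oU: "open U"
    unfolding U_def by (rule open_invertible)
  have "smooth_on U \<kappa>"
    unfolding \<kappa>_def
    by (intro smooth_on_diff smooth_on_bounded_linear[OF bounded_linear_scaleR_right]
        smooth_on_bilinear[OF bounded_bilinear_matrix_mult] smooth_on_matrix_inv
        smooth_on_add smooth_on_const smooth_on_id oU) (simp add: U_def)
  then have s1: "smooth_on U (\<lambda>J. \<kappa> J - g (\<kappa> J))"
    by (intro smooth_on_diff smooth_g oU)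
  have s2: "smooth_on V (\<lambda>y. \<tau> (y + g y))"
    unfolding \<tau>_def
    by (intro smooth_on_diff smooth_on_bounded_linear[OF bounded_linear_scaleR_right]
        smooth_on_bilinear[OF bounded_bilinear_matrix_mult] smooth_on_matrix_inv
        smooth_on_add smooth_on_const smooth_on_id smooth_g oV) (simp add: V_def)
  have diffeo: "smooth_diffeomorphism U V (\<lambda>J. \<kappa> J - g (\<kappa> J)) (\<lambda>y. \<tau> (y + g y))"
    by (rule smooth_diffeomorphismI[OF oU oV s1 s2]) (simp_all add: U_def V_def g_shift \<kappa> \<tau>)
  have "(\<lambda>J. \<kappa> J - g (\<kappa> J)) ` (U \<inter> M) = V \<inter> range P"
  proof (intro equalityI subsetI)
    fix y assume "y \<in> (\<lambda>J. \<kappa> J - g (\<kappa> J)) ` (U \<inter> M)"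
    then obtain J where J: "J \<in> U" "J \<in> M" "y = \<kappa> J - g (\<kappa> J)"
      by blast
    then have inv: "invertible (J + J0)"
      by (simp add: U_def)
    have "\<kappa> J = P (\<kappa> J) + g (\<kappa> J)"
      using M[OF \<kappa>(1)[OF inv]] \<kappa>(2)[OF inv] J(2) by (simp add: \<tau>_def)
    then have "y = P (\<kappa> J)"
      using J(3) by (metis add_diff_cancel_right')
    moreover have "y \<in> V"
      using J(3) \<kappa>(1)[OF inv] by (simp add: V_def g_shift)
    ultimately show "y \<in> V \<inter> range P"
      by blast
  next
    fix y assume y: "y \<in> V \<inter> range P"
    define K where "K = y + g y"
    have inv: "invertible (mat 1 + K)"
      using y by (simp add: V_def K_def)
    have "P y = y"
      using y PP by auto
    then have "K = P K + g K"
      by (simp add: K_def linear_add[OF P] Pg g_shift)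
    then have "\<tau> K \<in> M"
      using M[OF inv] by (simp add: \<tau>_def)
    moreover have "\<tau> K \<in> U" "y = \<kappa> (\<tau> K) - g (\<kappa> (\<tau> K))"
      using \<tau>[OF inv] by (simp_all add: U_def K_def g_shift)
    ultimately show "y \<in> (\<lambda>J. \<kappa> J - g (\<kappa> J)) ` (U \<inter> M)"
      by blast
  qed
  moreover have "p \<in> U" "subspace (range P)"
    using p linear_subspace_image[OF P subspace_UNIV] by (simp_all add: U_def)
  ultimately show ?thesis
    unfolding slice_chart_at_def using diffeo by blast
qed

lemma forall_6: "(\<forall>i::6. P i) \<longleftrightarrow> P 1 \<and> P 2 \<and> P 3 \<and> P 4 \<and> P 5 \<and> P 6"
proof -
  have "(\<forall>i::6. P i) \<longleftrightarrow> (\<forall>i\<in>{1, 2, 3, 4, 5, 6}. P i)"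
    unfolding UNIV_6[symmetric] by simp
  then show ?thesis by simp
qed

section \<open>Complex coordinates on M5\<close>

text \<open>The sign \<open>e = \<plusminus>1\<close> decides whether the second coordinate is conjugated: the bracket is
  complex bilinear for \<open>e = 1\<close>, and \<open>e = -1\<close> belongs to complex structures acting
  as \<open>diag(i, -i)\<close> modulo the centre.\<close>

definition coord1 :: "real^6 \<Rightarrow> complex" where "coord1 X = Complex (X $ 1) (- X $ 2)"
definition coord2 :: "real \<Rightarrow> real^6 \<Rightarrow> complex" where "coord2 e X = Complex (X $ 3) (e * X $ 4)"
definition coord3 :: "real^6 \<Rightarrow> complex" where "coord3 X = Complex (X $ 5) (X $ 6)"

definition vec3 :: "real \<Rightarrow> complex \<Rightarrow> complex \<Rightarrow> complex \<Rightarrow> real^6" where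
  "vec3 e a b c = (\<chi> i. if i = 1 then Re a else if i = 2 then - Im a else if i = 3 then Re b
     else if i = 4 then e * Im b else if i = 5 then Re c else Im c)"

lemma coords_vec3 [simp]:
  "coord1 (vec3 e a b c) = a" "e * e = 1 \<Longrightarrow> coord2 e (vec3 e a b c) = b" "coord3 (vec3 e a b c) = c"
  by (simp_all add: coord1_def coord2_def coord3_def vec3_def complex_eq_iff mult.assoc[symmetric])

lemma vec3_coords: "e * e = 1 \<Longrightarrow> vec3 e (coord1 X) (coord2 e X) (coord3 X) = X"
  by (simp add: coord1_def coord2_def coord3_def vec3_def vec_eq_iff forall_6 mult.assoc[symmetric])

lemma vec3_eq_iff: "e * e = 1 \<Longrightarrow> vec3 e a b c = vec3 e a' b' c' \<longleftrightarrow> a = a' \<and> b = b' \<and> c = c'"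
  by (metis coords_vec3)

lemma vec3_0_iff: "e * e = 1 \<Longrightarrow> vec3 e a b c = 0 \<longleftrightarrow> a = 0 \<and> b = 0 \<and> c = 0"
proof -
  have "vec3 e 0 0 0 = 0" by (simp add: vec3_def vec_eq_iff forall_6)
  then show "e * e = 1 \<Longrightarrow> ?thesis" by (metis vec3_eq_iff)
qed

lemma vec3_linear:
  "vec3 e a b c + vec3 e a' b' c' = vec3 e (a + a') (b + b') (c + c')"
  "vec3 e a b c - vec3 e a' b' c' = vec3 e (a - a') (b - b') (c - c')"
  "- vec3 e a b c = vec3 e (- a) (- b) (- c)"
  "r *\<^sub>R vec3 e a b c = vec3 e (of_real r * a) (of_real r * b) (of_real r * c)"
  by (simp_all add: vec3_def vec_eq_iff forall_6 algebra_simps)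

lemma coords_linear:
  "coord1 (X + Y) = coord1 X + coord1 Y" "coord2 e (X + Y) = coord2 e X + coord2 e Y"
    "coord3 (X + Y) = coord3 X + coord3 Y"
  "coord1 (r *\<^sub>R X) = of_real r * coord1 X" "coord2 e (r *\<^sub>R X) = of_real r * coord2 e X"
    "coord3 (r *\<^sub>R X) = of_real r * coord3 X"
  by (simp_all add: coord1_def coord2_def coord3_def complex_eq_iff algebra_simps)

text \<open>The minus sign in \<open>coord1\<close> means that x2 = -i x1, while x4 = i x3 and x6 =
  i x5 for \<open>e = 1\<close>; the bracket table then says exactly that the bracket is this
  complex determinant. The result is central, and there \<open>vec3 e\<close> does not depend on
  \<open>e\<close>.\<close>

lemma M5_bracket_coords: "M5_bracket X Y = vec3 e 0 0 (coord1 X * coord2 1 Y - coord1 Y * coord2 1 X)"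
  by (simp add: M5_bracket_def vec3_def coord1_def coord2_def vec_eq_iff forall_6)

lemma coord2_twist: "coord2 (-1) X = cnj (coord2 1 X)"
  by (simp add: coord2_def complex_eq_iff)

lemma vec3_twist: "vec3 (-1) a b c = vec3 1 a (cnj b) c"
  by (simp add: vec3_def vec_eq_iff forall_6)

text \<open>Multiplication by i in the coordinates for \<open>e\<close>. In the untwisted
  coordinates the case \<open>e = -1\<close> is diag(i, -i, i).\<close>

definition I_map :: "real \<Rightarrow> real^6 \<Rightarrow> real^6" where
  "I_map e X = vec3 e (\<i> * coord1 X) (\<i> * coord2 e X) (\<i> * coord3 X)"

type_synonym params =
  "complex \<times> complex \<times> complex \<times> complex \<times> complex \<times> complex \<times> complex"

text \<open>The general conjugate-linear map preserving the centre, in block form: the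
  \<open>s\<close> entries act on the quotient by the centre, \<open>k1\<close> and
  \<open>k2\<close> send the quotient into the centre, and \<open>\<kappa>\<close> acts on the
  centre.\<close>

definition conj_map :: "real \<Rightarrow> params \<Rightarrow> real^6 \<Rightarrow> real^6" where
  "conj_map e = (\<lambda>(s11, s12, s21, s22, k1, k2, \<kappa>) X.
     vec3 e (s11 * cnj (coord1 X) + s12 * cnj (coord2 e X)) (s21 * cnj (coord1 X)
         + s22 * cnj (coord2 e X))
       (k1 * cnj (coord1 X) + k2 * cnj (coord2 e X) + \<kappa> * cnj (coord3 X)))"

definition read_params :: "real \<Rightarrow> (real^6 \<Rightarrow> real^6) \<Rightarrow> params" where
  "read_params e K =
     (coord1 (K (vec3 e 1 0 0)), coord1 (K (vec3 e 0 1 0)), coord2 e (K (vec3 e 1 0 0)),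
         coord2 e (K (vec3 e 0 1 0)),
      coord3 (K (vec3 e 1 0 0)), coord3 (K (vec3 e 0 1 0)), coord3 (K (vec3 e 0 0 1)))"

lemma linear_I_map: "linear (I_map e)"
  by (intro linearI) (simp_all add: I_map_def coords_linear vec3_linear algebra_simps)

lemma I_map_I_map: "e * e = 1 \<Longrightarrow> I_map e (I_map e X) = - X"
  using vec3_coords[of e X] vec3_linear(3)[of e "coord1 X" "coord2 e X" "coord3 X"]
  by (simp add: I_map_def)

lemma linear_conj_map: "linear (conj_map e s)"
  by (intro linearI; cases s; simp add: conj_map_def coords_linear vec3_linear; simp add:
      algebra_simps)

lemma conj_map_linear_params: "linear (\<lambda>s. conj_map e s X)"
proof (intro linearI)
  fix s t :: params and r :: real
  obtain s11 s12 s21 s22 k1 k2 \<kappa> where s: "s = (s11, s12, s21, s22, k1, k2, \<kappa>)"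
    by (metis prod_cases7)
  obtain t11 t12 t21 t22 l1 l2 \<mu> where t: "t = (t11, t12, t21, t22, l1, l2, \<mu>)"
    by (metis prod_cases7)
  show "conj_map e (s + t) X = conj_map e s X + conj_map e t X"
    unfolding s t by (simp add: conj_map_def vec3_linear) (simp add: algebra_simps)
  show "conj_map e (r *\<^sub>R s) X = r *\<^sub>R conj_map e s X"
    unfolding s by (simp add: conj_map_def vec3_linear) (simp add: scaleR_conv_of_real algebra_simps)
qed

lemma read_params_conj_map: "e * e = 1 \<Longrightarrow> read_params e (conj_map e s) = s"
  by (cases s) (simp add: read_params_def conj_map_def)

lemma conj_map_I_map: "e * e = 1 \<Longrightarrow> conj_map e s (I_map e X) = - I_map e (conj_map e s X)"
  by (cases s) (simp add: conj_map_def I_map_def vec3_linear algebra_simps)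

text \<open>A conjugate-linear map is determined by its values on the three complex basis vectors,
  and \<open>cen\<close> makes two of its nine complex entries vanish.\<close>

lemma conj_map_read_params:
  assumes e: "e * e = 1" and K: "linear K" and anti: "\<And>X. K (I_map e X) = - I_map e (K X)"
    and cen: "\<And>c. coord1 (K (vec3 e 0 0 c)) = 0 \<and> coord2 e (K (vec3 e 0 0 c)) = 0"
  shows "K = conj_map e (read_params e K)"
proof
  fix X
  have lin: "K (vec3 e (z * a) (z * b) (z * c))
      = Re z *\<^sub>R K (vec3 e a b c) - Im z *\<^sub>R I_map e (K (vec3 e a b c))"
    for z a b c
  proof -
    have "vec3 e (z * a) (z * b) (z * c) = Re z *\<^sub>R vec3 e a b c + Im z *\<^sub>R I_map e (vec3 e a b c)"
      using e by (simp add: I_map_def vec3_linear complex_eq_iff vec3_eq_iff)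
    then show ?thesis
      by (simp add: linear_add[OF K] linear_scale[OF K] anti)
  qed
  have cj: "Re z *\<^sub>R Y - Im z *\<^sub>R I_map e Y = vec3 e (cnj z * coord1 Y) (cnj z * coord2 e Y) (cnj z
      * coord3 Y)" for z Y
  proof -
    have "Re z *\<^sub>R vec3 e (coord1 Y) (coord2 e Y) (coord3 Y) - Im z *\<^sub>R I_map e Y =
        vec3 e (cnj z * coord1 Y) (cnj z * coord2 e Y) (cnj z * coord3 Y)"
      using e by (simp add: I_map_def vec3_linear complex_eq_iff vec3_eq_iff)
    then show ?thesis using vec3_coords[OF e] by simp
  qed
  have "X = vec3 e (coord1 X * 1) (coord1 X * 0) (coord1 X * 0)
      + vec3 e (coord2 e X * 0) (coord2 e X * 1) (coord2 e X * 0)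
      + vec3 e (coord3 X * 0) (coord3 X * 0) (coord3 X * 1)"
    using vec3_coords[OF e, of X] by (simp add: vec3_linear)
  then have "K X = K (vec3 e (coord1 X * 1) (coord1 X * 0) (coord1 X * 0))
      + K (vec3 e (coord2 e X * 0) (coord2 e X * 1) (coord2 e X * 0))
      + K (vec3 e (coord3 X * 0) (coord3 X * 0) (coord3 X * 1))"
    by (metis linear_add[OF K])
  then show "K X = conj_map e (read_params e K) X"
    unfolding lin cj using cen[of 1] by (simp add: conj_map_def read_params_def vec3_linear
        algebra_simps)
qed

text \<open>With \<open>E X = X + K X\<close> and \<open>D = D(X, Y)\<close> the determinant form, the brackets below depend
  only on \<open>P = pcoef\<cdot>D\<close> and \<open>Q = qcoef\<cdot>cnj D\<close>. Since $JE = EI$, integrability reads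
  \<open>J (2i(P - Q)) = - 2(P + Q)\<close> in the centre, that is \<open>Q = \<kappa>\<cdot>cnj P\<close>.\<close>

definition pcoef :: "real \<Rightarrow> params \<Rightarrow> complex" where
  "pcoef e = (\<lambda>(s11, s12, s21, s22, k1, k2, \<kappa>). if e = 1 then 1 else cnj s22)"
definition qcoef :: "real \<Rightarrow> params \<Rightarrow> complex" where
  "qcoef e = (\<lambda>(s11, s12, s21, s22, k1, k2, \<kappa>). if e = 1 then s11 * s22 - s12 * s21 else s11)"
definition centre_coef :: "params \<Rightarrow> complex" where
  "centre_coef = (\<lambda>(s11, s12, s21, s22, k1, k2, \<kappa>). \<kappa>)"

text \<open>The contributions linear in one argument and conjugate-linear in the other cancel in
  both combinations. The bilinear part is a multiple of \<open>D\<close> and the bi-conjugate part a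
  multiple of \<open>cnj D\<close>; \<open>k1\<close>, \<open>k2\<close> and \<open>\<kappa>\<close>
  disappear because they only produce central terms.\<close>

lemma bracket_conj_map:
  fixes e :: real and s :: params
  defines "E \<equiv> \<lambda>X. X + conj_map e s X"
  assumes e: "e = 1 \<or> e = -1"
  defines "D \<equiv> \<lambda>X Y. coord1 X * coord2 e Y - coord1 Y * coord2 e X"
  shows "M5_bracket (E (I_map e X)) (E (I_map e Y)) - M5_bracket (E X) (E Y) =
      vec3 e 0 0 (- 2 * (pcoef e s * D X Y + qcoef e s * cnj (D X Y)))"
    and "M5_bracket (E (I_map e X)) (E Y) + M5_bracket (E X) (E (I_map e Y)) =
      vec3 e 0 0 (2 * \<i> * (pcoef e s * D X Y - qcoef e s * cnj (D X Y)))"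
proof -
  obtain s11 s12 s21 s22 k1 k2 \<kappa> where s: "s = (s11, s12, s21, s22, k1, k2, \<kappa>)"
    by (metis prod_cases7)
  show "M5_bracket (E (I_map e X)) (E (I_map e Y)) - M5_bracket (E X) (E Y) =
      vec3 e 0 0 (- 2 * (pcoef e s * D X Y + qcoef e s * cnj (D X Y)))"
    and "M5_bracket (E (I_map e X)) (E Y) + M5_bracket (E X) (E (I_map e Y)) =
      vec3 e 0 0 (2 * \<i> * (pcoef e s * D X Y - qcoef e s * cnj (D X Y)))"
    using e
    by (elim disjE; simp add: E_def D_def s M5_bracket_coords[of _ _ e] conj_map_def I_map_def
        pcoef_def qcoef_def vec3_linear coords_linear vec3_eq_iff coord2_twist vec3_twist; simp add:
            algebra_simps)+
qed

section \<open>Integrability as one equation\<close>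

lemma M5_bracket_centre: "M5_bracket X (vec3 e 0 0 c) = 0" "M5_bracket (vec3 e 0 0 c) X = 0"
  by (simp_all add: M5_bracket_def vec3_def vec_eq_iff)

lemma centreE:
  assumes "coord1 X = 0" "coord2 e X = 0" "e * e = 1"
  obtains "X = vec3 e 0 0 (coord3 X)"
  using vec3_coords[OF assms(3), of X] assms(1,2) by metis

text \<open>For central \<open>Z\<close> put \<open>Y = J Z\<close>; integrability gives
  \<open>J [X, Y] = [J X, Y]\<close>. If \<open>Y\<close> were not central, some \<open>X\<close>
  would satisfy \<open>[X, Y] = Z\<close>, and then \<open>Y = J Z = [J X, Y]\<close> would be
  central after all.\<close>

lemma complex_structure_centre:
  assumes J: "complex_structure M5_bracket J" and e: "e = 1 \<or> e = -1"
  shows "J (vec3 e 0 0 c) = vec3 e 0 0 (coord3 (J (vec3 e 0 0 c)))"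
proof (rule ccontr)
  have ee: "e * e = 1" using e by auto
  define Y where "Y = J (vec3 e 0 0 c)"
  have lin: "linear J" and N: "\<And>X Y. M5_bracket (J X) (J Y) - M5_bracket X Y
      - J (M5_bracket (J X) Y) - J (M5_bracket X (J Y)) = 0"
    using J by (auto simp: complex_structure_def)
  have *: "J (M5_bracket X Y) = M5_bracket (J X) Y" for X
    using N[of X "vec3 e 0 0 c"] by (simp add: M5_bracket_centre Y_def linear_0[OF lin])
  assume "J (vec3 e 0 0 c) \<noteq> vec3 e 0 0 (coord3 (J (vec3 e 0 0 c)))"
  then have "coord1 Y \<noteq> 0 \<or> coord2 e Y \<noteq> 0"
    using centreE[OF _ _ ee] unfolding Y_def by metis
  then have nz: "coord1 Y \<noteq> 0 \<or> coord2 1 Y \<noteq> 0"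
    using e by (auto simp: coord2_twist)
  obtain X where "coord1 X * coord2 1 Y - coord1 Y * coord2 1 X = c"
  proof (cases "coord1 Y = 0")
    case True
    then show ?thesis using nz that[of "vec3 1 (c / coord2 1 Y) 0 0"] by simp
  next
    case False
    then show ?thesis using that[of "vec3 1 0 (- c / coord1 Y) 0"] by simp
  qed
  then have "Y = M5_bracket (J X) Y"
    unfolding *[symmetric] by (simp add: Y_def M5_bracket_coords[of X _ e])
  then have "coord1 Y = 0 \<and> coord2 e Y = 0"
    using ee by (metis M5_bracket_coords coords_vec3(1,2))
  then show False
    using \<open>coord1 Y \<noteq> 0 \<or> coord2 e Y \<noteq> 0\<close> by simp
qed

lemma complex_structures_M5_iff:
  "A \<in> complex_structures_M5 \<longleftrightarrow> complex_structure M5_bracket ((*v) A)"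
proof
  assume "A \<in> complex_structures_M5"
  then obtain J where J: "A = matrix J" "complex_structure M5_bracket J"
    by (auto simp: complex_structures_M5_def)
  then have "linear J" by (simp add: complex_structure_def)
  then have "(*v) A = J"
    using matrix_works[of J] by (auto simp: J(1) linear_matrix_vector_mul_eq)
  then show "complex_structure M5_bracket ((*v) A)"
    using J(2) by simp
next
  assume "complex_structure M5_bracket ((*v) A)"
  then show "A \<in> complex_structures_M5"
    unfolding complex_structures_M5_def using matrix_of_matrix_vector_mul[of A] by force
qed

text \<open>With \<open>E = 1 + K\<close> the hypothesis is \<open>(J + I) E = 2 I\<close>. Under
  it, \<open>J E = E I\<close> is equivalent to \<open>K I = - I K\<close>, so \<open>E\<close>
  carries \<open>I\<close> to \<open>J\<close> and integrability can be tested on vectors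
  \<open>E X\<close>, where \<open>bracket_conj_map\<close> applies.\<close>

lemma cayley_complex_structure_iff:
  fixes J K :: "real^6 \<Rightarrow> real^6"
  assumes e: "e = 1 \<or> e = -1" and lin: "linear J" "linear K"
    and bij: "bij (\<lambda>X. X + K X)"
    and J: "\<And>X. J (X + K X) + I_map e (X + K X) = 2 *\<^sub>R I_map e X"
  shows "complex_structure M5_bracket J \<longleftrightarrow>
    K = conj_map e (read_params e K) \<and>
    qcoef e (read_params e K) = centre_coef (read_params e K) * cnj (pcoef e (read_params e K))"
proof -
  define E where "E X = X + K X" for X
  define s where "s = read_params e K"
  define D where "D X Y = coord1 X * coord2 e Y - coord1 Y * coord2 e X" for X Y
  have ee: "e * e = 1" using e by auto
  note II = I_map_I_map[OF ee]
  note linI = linear_I_map[of e]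
  have JE: "J (E X) + I_map e (E X) = 2 *\<^sub>R I_map e X" for X
    using J by (simp add: E_def)
  have surjE: "\<exists>X. Y = E X" for Y
    using bij unfolding bij_def surj_def E_def by blast
  have bracket: "M5_bracket (E (I_map e X)) (E (I_map e Y)) - M5_bracket (E X) (E Y)
        - J (M5_bracket (E (I_map e X)) (E Y)) - J (M5_bracket (E X) (E (I_map e Y))) =
      vec3 e 0 0 (- 2 * (pcoef e s * D X Y + qcoef e s * cnj (D X Y)))
        - J (vec3 e 0 0 (2 * \<i> * (pcoef e s * D X Y - qcoef e s * cnj (D X Y))))"
    if "K = conj_map e s" for X Y
    using bracket_conj_map[OF e, where s = s and X = X
        and Y = Y, folded that, folded E_def D_def, symmetric]
    by (simp only: linear_add[OF lin(1)] diff_diff_eq add.assoc)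
  have JE_commute: "J (E X) = E (I_map e X)" if "\<And>X. K (I_map e X) = - I_map e (K X)" for X
    using JE[of X] that[of X]
    by (simp add: E_def linear_add[OF linI] algebra_simps scaleR_2)
  have J_centre: "J (vec3 e 0 0 (w + centre_coef s * cnj w))
      = vec3 e 0 0 (\<i> * (w - centre_coef s * cnj w))"
    if K: "K = conj_map e s" and JE': "\<And>X. J (E X) = E (I_map e X)" for w
  proof -
    have Ew: "E (vec3 e 0 0 w) = vec3 e 0 0 (w + centre_coef s * cnj w)" for w
      unfolding E_def K by (cases s) (simp add: conj_map_def vec3_linear centre_coef_def ee)
    have "I_map e (vec3 e 0 0 w) = vec3 e 0 0 (\<i> * w)"
      by (simp add: I_map_def ee)
    then show ?thesis
      using JE'[of "vec3 e 0 0 w"] unfolding Ew by (simp add: Ew algebra_simps)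
  qed
  show ?thesis
    unfolding s_def[symmetric]
  proof
    assume cs: "complex_structure M5_bracket J"
    then have JJ: "J (J X) = - X" for X
      by (simp add: complex_structure_def)
    have inj: "W = 0" if W: "J W + I_map e W = 0" for W
    proof -
      obtain X where X: "W = E X" using surjE by blast
      then have "I_map e X = 0" using JE[of X] W by simp
      then have "X = 0" using II[of X] linear_0[OF linI] by simp
      then show "W = 0" using X linear_0[OF lin(2)] by (simp add: E_def)
    qed
    \<comment> \<open>Both sides have the image \<open>-2 X\<close> under \<open>J + I\<close>,
      which is injective.\<close>
    have JE': "J (E X) = E (I_map e X)" for X
    proof -
      have 1: "J (E X) = 2 *\<^sub>R I_map e X - I_map e (E X)"
        using JE[of X] by (simp add: algebra_simps)
      have 2: "J (E (I_map e X)) + I_map e (E (I_map e X)) = - 2 *\<^sub>R X"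
        using JE[of "I_map e X"] by (simp add: II)
      have 3: "J (J (E X)) + I_map e (J (E X)) = - 2 *\<^sub>R X"
        unfolding JJ by (simp add: 1 linear_diff[OF linI] linear_scale[OF linI] II)
      have "J (J (E X) - E (I_map e X)) + I_map e (J (E X) - E (I_map e X)) = 0"
        using 2 3 by (simp add: linear_diff[OF linI] linear_diff[OF lin(1)] algebra_simps)
      from inj[OF this] show ?thesis by simp
    qed
    have anti: "K (I_map e X) = - I_map e (K X)" for X
      using JE[of X] JE'[of X]
      by (simp add: E_def linear_add[OF linI] eq_neg_iff_add_eq_0 algebra_simps scaleR_2)
    \<comment> \<open>\<open>h\<close> is \<open>J + I\<close> restricted to the centre, which
      \<open>J\<close> preserves. Being injective on a finite-dimensional space it is onto, and this
      forces \<open>E\<close>, hence \<open>K\<close>, to preserve the centre.\<close>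
    define h where "h c = coord3 (J (vec3 e 0 0 c) + I_map e (vec3 e 0 0 c))" for c
    have h: "J (vec3 e 0 0 c) + I_map e (vec3 e 0 0 c) = vec3 e 0 0 (h c)" for c
      using complex_structure_centre[OF cs e, of c]
      by (metis (no_types, lifting) I_map_def coords_vec3(1,2) ee h_def vec3_linear(1)
          mult_zero_right coords_vec3(3) add.right_neutral)
    have linmk: "linear (vec3 e 0 0)"
      by (intro linearI) (simp_all add: vec3_linear scaleR_conv_of_real[where 'a = complex])
    have "linear h"
    proof
      show "h (b + c) = h b + h c" for b c
        by (simp add: h_def linear_add[OF linmk] linear_add[OF lin(1)] linear_add[OF linI]
            coords_linear)
      show "h (r *\<^sub>R c) = r *\<^sub>R h c" for r c
        unfolding h_def linear_scale[OF linmk] linear_scale[OF lin(1)] linear_scale[OF linI]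
            coords_linear
        by (simp add: scaleR_conv_of_real distrib_left)
    qed
    moreover have "inj h"
    proof (subst linear_inj_iff_eq_0[OF \<open>linear h\<close>], intro allI impI)
      fix c assume "h c = 0"
      then have "J (vec3 e 0 0 c) + I_map e (vec3 e 0 0 c) = 0"
        using h[of c] by (simp add: vec3_0_iff[OF ee])
      from inj[OF this] show "c = 0" by (simp add: vec3_0_iff[OF ee])
    qed
    ultimately have "surj h"
      by (rule linear_injective_imp_surjective) (rule refl)
    have cen: "coord1 (K (vec3 e 0 0 c)) = 0 \<and> coord2 e (K (vec3 e 0 0 c)) = 0" for c
    proof -
      obtain c' where "2 * \<i> * c = h c'"
        using \<open>surj h\<close> by (metis surjD)
      then have "J (vec3 e 0 0 c') + I_map e (vec3 e 0 0 c') = 2 *\<^sub>R I_map e (vec3 e 0 0 c)"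
        unfolding h by (simp add: I_map_def vec3_linear ee mult.assoc[symmetric])
      then have "J (E (vec3 e 0 0 c) - vec3 e 0 0 c') + I_map e (E (vec3 e 0 0 c) - vec3 e 0 0 c')
          = 0"
        using JE[of "vec3 e 0 0 c"]
        by (simp add: linear_diff[OF lin(1)] linear_diff[OF linI] algebra_simps)
      from inj[OF this] have "E (vec3 e 0 0 c) - vec3 e 0 0 c' = 0" .
      then have "K (vec3 e 0 0 c) = vec3 e 0 0 (c' - c)"
        using vec3_linear(2)[of e 0 0 c' 0 0 c] by (simp add: E_def algebra_simps)
      then show ?thesis by (simp add: ee)
    qed
    have K: "K = conj_map e s"
      unfolding s_def by (rule conj_map_read_params[OF ee lin(2) anti cen])
    have N: "M5_bracket (J X) (J Y) - M5_bracket X Y - J (M5_bracket (J X) Y)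
        - J (M5_bracket X (J Y)) = 0"
      for X Y using cs by (simp add: complex_structure_def)
    \<comment> \<open>One pair of vectors with \<open>D = 1\<close> already yields the full equation
      between the coefficients.\<close>
    have D1: "D (vec3 e 1 0 0) (vec3 e 0 1 0) = 1"
      by (simp add: D_def ee)
    have J1: "J (vec3 e 0 0 (2 * \<i> * (pcoef e s - qcoef e s)))
        = vec3 e 0 0 (- 2 * (pcoef e s + qcoef e s))"
      using N[of "E (vec3 e 1 0 0)" "E (vec3 e 0 1 0)"] bracket[OF K, of "vec3 e 1 0 0"
          "vec3 e 0 1 0"]
      by (simp add: D1 JE')
    \<comment> \<open>The defect of the equation. Integrability and \<open>J_centre\<close> describe
      \<open>J\<close> on two central vectors that differ by \<open>2 i d\<close>; subtracting gives
      \<open>J (2 i d) = 2 d = - I (2 i d)\<close>, so \<open>d = 0\<close> by injectivity of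
      \<open>J + I\<close>.\<close>
    define d where "d = qcoef e s - centre_coef s * cnj (pcoef e s)"
    have J2: "J (vec3 e 0 0 (2 * \<i> * (pcoef e s - centre_coef s * cnj (pcoef e s)))) =
        vec3 e 0 0 (- 2 * (pcoef e s + centre_coef s * cnj (pcoef e s)))"
      using J_centre[OF K JE', of "2 * \<i> * pcoef e s"] by (simp add: algebra_simps)
    have "vec3 e 0 0 (2 * \<i> * d) = vec3 e 0 0 (2 * \<i> * (pcoef e s - centre_coef s * cnj (pcoef e s)))
        - vec3 e 0 0 (2 * \<i> * (pcoef e s - qcoef e s))"
      by (simp add: vec3_linear d_def algebra_simps)
    then have "J (vec3 e 0 0 (2 * \<i> * d)) = vec3 e 0 0 (2 * d)"
      by (simp add: linear_diff[OF lin(1)] J1 J2) (simp add: vec3_linear d_def algebra_simps)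
    then have "J (vec3 e 0 0 (2 * \<i> * d)) + I_map e (vec3 e 0 0 (2 * \<i> * d)) = 0"
      by (simp add: I_map_def ee vec3_linear vec3_0_iff complex_eq_iff)
    from inj[OF this] have "d = 0"
      by (simp add: vec3_0_iff[OF ee])
    then show "K = conj_map e s \<and> qcoef e s = centre_coef s * cnj (pcoef e s)"
      using K by (simp add: d_def)
  next
    assume asm: "K = conj_map e s \<and> qcoef e s = centre_coef s * cnj (pcoef e s)"
    have JE': "J (E X) = E (I_map e X)" for X
      using asm by (intro JE_commute) (metis conj_map_I_map[OF ee])
    have JJ: "J (J X) = - X" for X
    proof -
      obtain X' where "X = E X'" using surjE by blast
      then show ?thesis
        by (simp add: JE' II) (simp add: E_def linear_neg[OF lin(2)])
    qed
    have N: "M5_bracket (J X) (J Y) - M5_bracket X Y - J (M5_bracket (J X) Y)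
        - J (M5_bracket X (J Y)) = 0"
      for X Y
    proof -
      obtain X' Y' where XY: "X = E X'" "Y = E Y'" using surjE by metis
      \<comment> \<open>Multiplying the coefficient equation by \<open>cnj (D X' Y')\<close> turns
        it into the relation needed for this pair, and \<open>J_centre\<close> at
        \<open>2 i p\<close> is then the integrability condition.\<close>
      define p where "p = pcoef e s * D X' Y'"
      have q: "qcoef e s * cnj (D X' Y') = centre_coef s * cnj p"
        using asm by (simp add: p_def)
      have "J (vec3 e 0 0 (2 * \<i> * (p - centre_coef s * cnj p)))
          = vec3 e 0 0 (- 2 * (p + centre_coef s * cnj p))"
        using J_centre[OF _ JE', of "2 * \<i> * p"] asm by (simp add: algebra_simps)
      then show ?thesis
        using bracket[of X' Y'] asm unfolding XY JE' q p_def[symmetric] by simp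
    qed
    show "complex_structure M5_bracket J"
      unfolding complex_structure_def using lin(1) JJ N by blast
  qed
qed

section \<open>Matrices of conjugate-linear maps and the graph of solutions\<close>

lemma matrix_works_real: "linear f \<Longrightarrow> matrix f *v x = f (x :: real^'n)"
  by (simp add: matrix_works linear_matrix_vector_mul_eq)

lemma matrix_vector_mult_minus: "(- A) *v x = - (A *v x)" for A :: "real^'n^'m"
  using matrix_vector_mult_diff_rdistrib[of 0 A x] by simp

lemma invertible_iff_ker:
  fixes A :: "real^'n^'n"
  shows "invertible A \<longleftrightarrow> (\<forall>x. A *v x = 0 \<longrightarrow> x = 0)"
  by (simp add: invertible_left_inverse matrix_left_invertible_ker)

lemma linear_read_params: "linear (\<lambda>K. read_params e ((*v) K))"
  by (intro linearI)
    (simp_all add: read_params_def matrix_vector_mult_add_rdistrib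
        scaleR_matrix_vector_assoc[symmetric]
      coords_linear scaleR_conv_of_real[where 'a = complex])

definition conj_matrix :: "real \<Rightarrow> params \<Rightarrow> real^6^6" where
  "conj_matrix e s = matrix (conj_map e s)"

lemma conj_matrix_works: "conj_matrix e s *v X = conj_map e s X"
  by (simp add: conj_matrix_def matrix_works_real linear_conj_map)

lemma linear_conj_matrix: "linear (conj_matrix e)"
  by (intro linearI)
    (simp_all add: matrix_eq conj_matrix_works matrix_vector_mult_add_rdistrib
      scaleR_matrix_vector_assoc[symmetric] linear_add[OF conj_map_linear_params]
      linear_scale[OF conj_map_linear_params])

lemma read_params_conj_matrix: "e * e = 1 \<Longrightarrow> read_params e ((*v) (conj_matrix e s)) = s"
  using read_params_conj_map[of e s] by (simp add: conj_matrix_works[abs_def] eta_contract_eq)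

text \<open>The integrability equation is solved for \<open>\<kappa>\<close> if \<open>e = 1\<close>, and for \<open>s11\<close> if \<open>e = -1\<close>.\<close>

type_synonym free_params = "complex \<times> complex \<times> complex \<times> complex \<times> complex \<times> complex"

definition embed_params :: "real \<Rightarrow> free_params \<Rightarrow> params" where
  "embed_params e = (\<lambda>(x1, x2, x3, x4, x5, x6).
     if e = 1 then (x1, x2, x3, x4, x5, x6, 0) else (0, x1, x2, x3, x4, x5, x6))"

definition free_part :: "real \<Rightarrow> params \<Rightarrow> free_params" where
  "free_part e = (\<lambda>(s11, s12, s21, s22, k1, k2, \<kappa>).
     if e = 1 then (s11, s12, s21, s22, k1, k2) else (s12, s21, s22, k1, k2, \<kappa>))"

definition embed_dependent :: "real \<Rightarrow> complex \<Rightarrow> params" where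
  "embed_dependent e d = (if e = 1 then (0, 0, 0, 0, 0, 0, d) else (d, 0, 0, 0, 0, 0, 0))"

definition dependent_value :: "real \<Rightarrow> params \<Rightarrow> complex" where
  "dependent_value e = (\<lambda>(s11, s12, s21, s22, k1, k2, \<kappa>).
     if e = 1 then s11 * s22 - s12 * s21 else \<kappa> * s22)"

lemma linear_params:
  "linear (embed_params e)" "linear (free_part e)" "linear (embed_dependent e)"
  by (intro linearI; force simp: embed_params_def free_part_def embed_dependent_def)+

lemma params_simps:
  "free_part e (embed_params e x) = x" "free_part e (embed_dependent e d) = 0"
  "dependent_value e (embed_params e (free_part e s)) = dependent_value e s"
  by (auto simp: embed_params_def free_part_def embed_dependent_def dependent_value_def zero_prod_def
      split: prod.splits)

text \<open>The equation reads \<open>\<kappa> = s11 s22 - s12 s21\<close> for \<open>e = 1\<close>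
  and \<open>s11 = \<kappa> s22\<close> for \<open>e = -1\<close>; in both cases one parameter is a
  polynomial in the other six.\<close>

lemma params_graph_iff:
  assumes "e = 1 \<or> e = -1"
  shows "qcoef e s = centre_coef s * cnj (pcoef e s) \<longleftrightarrow>
    s = embed_params e (free_part e s) + embed_dependent e (dependent_value e s)"
  using assms
  by (auto simp: qcoef_def pcoef_def centre_coef_def embed_params_def free_part_def
      embed_dependent_def dependent_value_def zero_prod_def split: prod.splits)

lemma smooth_on_dependent_value:
  assumes "open U" "smooth_on U f"
  shows "smooth_on U (\<lambda>x. dependent_value e (f x))"
proof -
  have "linear (\<lambda>s::params. fst s)" "linear (\<lambda>s::params. fst (snd s))"
    "linear (\<lambda>s::params. fst (snd (snd s)))" "linear (\<lambda>s::params. fst (snd (snd (snd s))))"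
    "linear (\<lambda>s::params. snd (snd (snd (snd (snd (snd s))))))"
    by (intro linearI; simp)+
  note sm = this[THEN smooth_on_linear, OF assms]
  have "smooth_on U (\<lambda>x. fst (f x) * fst (snd (snd (snd (f x))))
      - fst (snd (f x)) * fst (snd (snd (f x))))"
    by (intro smooth_on_diff smooth_on_mult sm assms(1))
  moreover have "smooth_on U (\<lambda>x. snd (snd (snd (snd (snd (snd (f x)))))) * fst (snd (snd (snd (f
      x)))))"
    by (intro smooth_on_mult sm assms(1))
  ultimately show ?thesis
    by (cases "e = 1") (simp_all add: dependent_value_def case_prod_beta)
qed

lemma slice_chart_at_M5:
  assumes e: "e = 1 \<or> e = -1" and p: "invertible (p + matrix (I_map e))"
  shows "slice_chart_at 12 complex_structures_M5 p"
proof -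
  have ee: "e * e = 1" using e by auto
  define J0 where "J0 = matrix (I_map e)"
  define rd where "rd K = read_params e ((*v) K)" for K
  \<comment> \<open>\<open>P\<close> keeps the six free parameters read from a matrix and discards
    the rest; \<open>g\<close> is the matrix carrying only the dependent parameter computed from
    them.\<close>
  define P where "P K = conj_matrix e (embed_params e (free_part e (rd K)))" for K
  define g where "g K = conj_matrix e (embed_dependent e (dependent_value e (rd K)))" for K
  have J0_works: "J0 *v X = I_map e X" for X
    by (simp add: J0_def matrix_works_real linear_I_map)
  have rd_lin: "linear rd"
    using linear_read_params unfolding rd_def[abs_def] .
  have rd_conj: "rd (conj_matrix e s) = s" for s
    by (simp add: rd_def read_params_conj_matrix[OF ee])
  have linP: "linear P"
    using linear_compose[OF linear_compose[OF linear_compose[OF rd_lin linear_params(2)[of e]]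
          linear_params(1)[of e]] linear_conj_matrix[of e]]
    by (simp add: P_def[abs_def] o_def)
  have "slice_chart_at (dim (range P)) complex_structures_M5 p"
  proof (rule slice_chart_at_cayley[where ?J0.0 = J0 and P = P and g = g])
    show "J0 ** J0 = - mat 1"
      by (simp add: matrix_eq matrix_vector_mul_assoc[symmetric] J0_works I_map_I_map[OF ee]
          matrix_vector_mult_minus)
    show "invertible (p + J0)" using p by (simp add: J0_def)
    show "linear P" by (rule linP)
    show "P (P K) = P K" "P (g K) = 0" "g (P K) = g K" for K
      by (simp_all add: P_def g_def rd_conj params_simps linear_0[OF linear_conj_matrix]
          linear_0[OF linear_params(1)])
    show "smooth_on U (\<lambda>x. g (f x))" if "open U" "smooth_on U f" for U and f :: "real^6^6 \<Rightarrow> real^6^6"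
      unfolding g_def
      by (intro smooth_on_linear[OF linear_conj_matrix] smooth_on_linear[OF linear_params(3)]
          smooth_on_dependent_value smooth_on_linear[OF rd_lin] that)
    show "2 *\<^sub>R (J0 ** matrix_inv (mat 1 + K)) - J0 \<in> complex_structures_M5 \<longleftrightarrow> K = P K + g K"
      if K: "invertible (mat 1 + K)" for K
    proof -
      define A where "A = 2 *\<^sub>R (J0 ** matrix_inv (mat 1 + K)) - J0"
      have EK: "(mat 1 + K) *v X = X + K *v X" for X
        by (simp add: matrix_vector_mult_add_rdistrib)
      have "bij (\<lambda>X. X + K *v X)"
        unfolding EK[symmetric]
        by (rule o_bij[of "(*v) (matrix_inv (mat 1 + K))"])
          (simp_all add: fun_eq_iff matrix_vector_mul_assoc matrix_inv_left[OF K]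
              matrix_inv_right[OF K])
      moreover have "A *v (X + K *v X) + I_map e (X + K *v X) = 2 *\<^sub>R I_map e X" for X
      proof -
        have "(A + J0) ** (mat 1 + K) = 2 *\<^sub>R (J0 ** (matrix_inv (mat 1 + K) ** (mat 1 + K)))"
          by (simp add: A_def matrix_mult_linear matrix_mul_assoc)
        also have "\<dots> = 2 *\<^sub>R J0"
          by (simp add: matrix_inv_left[OF K])
        finally have "(A + J0) *v ((mat 1 + K) *v X) = (2 *\<^sub>R J0) *v X"
          by (simp add: matrix_vector_mul_assoc)
        then show ?thesis
          by (simp only: EK matrix_vector_mult_add_rdistrib[of A] J0_works
              scaleR_matrix_vector_assoc[symmetric])
      qed
      ultimately have "A \<in> complex_structures_M5 \<longleftrightarrow>
          (*v) K = conj_map e (rd K) \<and> qcoef e (rd K) = centre_coef (rd K) * cnj (pcoef e (rd K))"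
        unfolding complex_structures_M5_iff rd_def
        by (intro cayley_complex_structure_iff[OF e]) simp_all
      also have "\<dots> \<longleftrightarrow> K = conj_matrix e (rd K) \<and>
          rd K = embed_params e (free_part e (rd K)) + embed_dependent e (dependent_value e (rd K))"
        unfolding params_graph_iff[OF e] by (simp add: fun_eq_iff matrix_eq conj_matrix_works)
      \<comment> \<open>Reading the parameters of \<open>conj_matrix e t\<close> returns
        \<open>t\<close>, so the two conditions merge into one equation for
        \<open>K\<close>.\<close>
      also have "\<dots> \<longleftrightarrow>
          K = conj_matrix e (embed_params e (free_part e (rd K))
              + embed_dependent e (dependent_value e (rd K)))"
        by (metis rd_conj)
      also have "\<dots> \<longleftrightarrow> K = P K + g K"
        by (simp add: P_def g_def linear_add[OF linear_conj_matrix])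
      finally show ?thesis
        by (simp add: A_def)
    qed
  qed
  moreover have "dim (range P) = 12"
  proof -
    \<comment> \<open>An injective linear parametrization of \<open>range P\<close> by six complex
      numbers, whence the real dimension 12.\<close>
    define F where "F x = conj_matrix e (embed_params e x)" for x
    have linF: "linear F"
      using linear_compose[OF linear_params(1)[of e] linear_conj_matrix[of e]]
          by (simp add: F_def[abs_def] o_def)
    have "P (F x) = F x" "P K = F (free_part e (rd K))" for x K
      by (simp_all add: F_def P_def rd_conj params_simps)
    note PF = this(1)[symmetric] this(2)
    have "range P = range F"
    proof (intro equalityI image_subsetI)
      show "P K \<in> range F" for K
        unfolding PF(2) by (rule rangeI)
      show "F x \<in> range P" for x
        by (subst PF(1)) (rule rangeI)
    qed
    moreover have "inj F"
      by (rule inj_on_inverseI[where g = "\<lambda>K. free_part e (rd K)"]) (simp add: F_def rd_conj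
          params_simps)
    then have "dim (range F) = dim (UNIV :: free_params set)"
      using dim_image_eq[OF linF, of UNIV] by simp
    ultimately show ?thesis
      by simp
  qed
  ultimately show ?thesis
    by simp
qed

section \<open>Covering by charts\<close>

lemma complex_structure_conj:
  assumes J: "complex_structure br J" and lin: "linear f" "linear g"
    and inv: "\<And>x. f (g x) = x" "\<And>x. g (f x) = x"
    and br: "\<And>x y. br (f x) (f y) = f (br x y)"
  shows "complex_structure br (\<lambda>x. g (J (f x)))"
proof -
  have br': "br (g x) (g y) = g (br x y)" for x y
    using br[of "g x" "g y"] by (metis inv)
  have N: "br (J X) (J Y) - br X Y - J (br (J X) Y) - J (br X (J Y)) = 0" for X Y
    using J by (simp add: complex_structure_def)
  have "br (g (J (f X))) (g (J (f Y))) - br X Y - g (J (f (br (g (J (f X))) Y)))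
      - g (J (f (br X (g (J (f Y)))))) = 0" for X Y
  proof -
    have "br (g (J (f X))) (g (J (f Y))) = g (br (J (f X)) (J (f Y)))" "br X Y = g (br (f X) (f Y))"
      by (simp_all add: br' br inv)
    moreover have "f (br (g (J (f X))) Y) = br (J (f X)) (f Y)"
        "f (br X (g (J (f Y)))) = br (f X) (J (f Y))"
      by (simp_all add: br[symmetric] inv)
    ultimately show ?thesis
      using N[of "f X" "f Y"] by (simp add: linear_diff[OF lin(2), symmetric] linear_0[OF lin(2)])
  qed
  moreover have "linear (\<lambda>x. g (J (f x)))"
    using J linear_compose[OF linear_compose[OF lin(1)] lin(2), of J]
    by (simp add: complex_structure_def o_def)
  moreover have "g (J (f (g (J (f X))))) = - X" for X
    using J by (simp add: complex_structure_def inv linear_neg[OF lin(2)])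
  ultimately show ?thesis
    unfolding complex_structure_def by blast
qed

text \<open>Every term of the integrability expression contains \<open>J\<close> either twice or not
  at all, so the expression is even in \<open>J\<close>.\<close>

lemma complex_structure_uminus:
  assumes "bilinear br" "complex_structure br J"
  shows "complex_structure br (\<lambda>x. - J x)"
proof -
  have "linear J" "\<And>X Y. br (J X) (J Y) - br X Y - J (br (J X) Y) - J (br X (J Y)) = 0"
    using assms(2) by (auto simp: complex_structure_def)
  then show ?thesis
    using assms(2) unfolding complex_structure_def
    by (auto simp: bilinear_lneg[OF assms(1)] bilinear_rneg[OF assms(1)] linear_neg
        linear_compose_neg)
qed

lemma uminus_complex_structures_M5: "- A \<in> complex_structures_M5 \<longleftrightarrow> A \<in> complex_structures_M5"
proof -
  have "- B \<in> complex_structures_M5" if "B \<in> complex_structures_M5" for B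
    using complex_structure_uminus[OF M5_bracket_bilinear, of "(*v) B"] that
    unfolding complex_structures_M5_iff matrix_vector_mult_minus[abs_def] .
  from this[of A] this[of "- A"] show ?thesis by auto
qed

lemma slice_chart_at_M5_uminus:
  assumes "slice_chart_at d complex_structures_M5 (- p)"
  shows "slice_chart_at d complex_structures_M5 p"
  by (rule slice_chart_at_linear[of uminus uminus])
    (use assms in \<open>simp_all add: uminus_complex_structures_M5 linear_compose_neg[OF linear_id,
        unfolded id_def]\<close>)

lemma slice_chart_at_M5_conj:
  assumes H: "invertible H" and br: "\<And>X Y. M5_bracket (H *v X) (H *v Y) = H *v M5_bracket X Y"
    and chart: "slice_chart_at d complex_structures_M5 (matrix_inv H ** p ** H)"
  shows "slice_chart_at d complex_structures_M5 p"
proof (rule slice_chart_at_linear[where L = "\<lambda>A. matrix_inv H ** A ** H" and L' =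
    "\<lambda>A. H ** A ** matrix_inv H"])
  let ?H' = "matrix_inv H"
  have inv: "H *v (?H' *v x) = x" "?H' *v (H *v x) = x" for x
    by (simp_all add: matrix_vector_mul_assoc matrix_inv_left[OF H] matrix_inv_right[OF H])
  show "linear (\<lambda>A. ?H' ** A ** H)" "linear (\<lambda>A. H ** A ** ?H')"
    by (intro linearI; simp add: matrix_mult_linear bounded_bilinear.add_left[OF
        bounded_bilinear_matrix_mult]
        bounded_bilinear.add_right[OF bounded_bilinear_matrix_mult])+
  show "slice_chart_at d complex_structures_M5 (?H' ** p ** H)"
    by (rule chart)
  show conj_inv: "H ** (?H' ** A ** H) ** ?H' = A" "?H' ** (H ** A ** ?H') ** H = A" for A
    by (simp_all add: matrix_eq matrix_vector_mul_assoc[symmetric] inv)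
  have comp: "(*v) (B ** A ** C) = (\<lambda>x. B *v (A *v (C *v x)))" for A B C :: "real^6^6"
    by (simp add: fun_eq_iff matrix_vector_mul_assoc[symmetric])
  have 1: "?H' ** A ** H \<in> complex_structures_M5" if "A \<in> complex_structures_M5" for A
    using complex_structure_conj[of M5_bracket "(*v) A" "(*v) H" "(*v) ?H'"] that inv br
    by (simp add: complex_structures_M5_iff comp)
  have br': "M5_bracket (?H' *v X) (?H' *v Y) = ?H' *v M5_bracket X Y" for X Y
    using br[of "?H' *v X" "?H' *v Y"] by (metis inv)
  have 2: "H ** A ** ?H' \<in> complex_structures_M5" if "A \<in> complex_structures_M5" for A
    using complex_structure_conj[of M5_bracket "(*v) A" "(*v) ?H'" "(*v) H"] that inv br'
    by (simp add: complex_structures_M5_iff comp)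
  show "?H' ** A ** H \<in> complex_structures_M5 \<longleftrightarrow> A \<in> complex_structures_M5" for A
    using 1[of A] 2[of "?H' ** A ** H"] conj_inv(1)[of A] by auto
qed

text \<open>Says that \<open>(a, b)\<close> satisfies the eigenvector equation for the map induced
  by \<open>J\<close> on the quotient C^2 by the centre; the zero vector is allowed, and
  \<open>J\<close> may be only real linear.\<close>

definition quotient_eigen :: "complex \<Rightarrow> (real^6 \<Rightarrow> real^6) \<Rightarrow> complex \<Rightarrow> complex \<Rightarrow> bool" where
  "quotient_eigen \<sigma> J a b \<longleftrightarrow> coord1 (J (vec3 1 a b 0)) = \<sigma> * a \<and> coord2 1 (J (vec3 1 a b 0)) = \<sigma> * b"

lemma vec3_scale: "vec3 1 (z * a) (z * b) (z * c)
    = Re z *\<^sub>R vec3 1 a b c + Im z *\<^sub>R I_map 1 (vec3 1 a b c)"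
  by (simp add: I_map_def vec3_linear complex_eq_iff vec3_eq_iff)

text \<open>With \<open>\<sigma> = s i\<close> and \<open>s = 1\<close> or \<open>s = -1\<close>,
  modulo the centre \<open>i v\<close> equals \<open>s J v\<close>; applying \<open>J\<close>, which
  preserves the centre, gives \<open>J (i v) = - s v = \<sigma> (i v)\<close>. So the equation holds
  on the whole complex line of \<open>v\<close>.\<close>

lemma quotient_eigen_scale:
  assumes J: "complex_structure M5_bracket J" and \<sigma>: "\<sigma> = \<i> \<or> \<sigma> = - \<i>" and eig:
      "quotient_eigen \<sigma> J a b"
  shows "quotient_eigen \<sigma> J (z * a) (z * b)"
proof -
  have lin: "linear J" and JJ: "J (J X) = - X" for X
    using J by (auto simp: complex_structure_def)
  let ?v = "vec3 1 a b 0"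
  define c where "c = coord3 (J ?v)"
  define s where "s = Im \<sigma>"
  have s: "\<sigma> = of_real s * \<i>" "s * s = 1"
    using \<sigma> by (auto simp: s_def complex_eq_iff)
  have Jv: "J ?v = vec3 1 (\<sigma> * a) (\<sigma> * b) c"
    using eig vec3_coords[of 1 "J ?v"] by (simp add: quotient_eigen_def c_def)
  then have "I_map 1 ?v = s *\<^sub>R J ?v - vec3 1 0 0 (of_real s * c)"
    using s(2) by (simp add: I_map_def vec3_linear vec3_eq_iff s(1) complex_eq_iff algebra_simps)
  then have "J (I_map 1 ?v) = s *\<^sub>R (- ?v) - J (vec3 1 0 0 (of_real s * c))"
    by (simp only: linear_diff[OF lin] linear_scale[OF lin] JJ)
  then have JI: "J (I_map 1 ?v) =
      vec3 1 (- of_real s * a) (- of_real s * b) (- coord3 (J (vec3 1 0 0 (of_real s * c))))"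
    by (subst (asm) complex_structure_centre[OF J, of 1]) (simp_all add: vec3_linear)
  have "J (vec3 1 (z * a) (z * b) 0) = Re z *\<^sub>R J ?v + Im z *\<^sub>R J (I_map 1 ?v)"
    using vec3_scale[of z a b 0] by (simp add: linear_add[OF lin] linear_scale[OF lin])
  then show ?thesis
    unfolding JI Jv by (simp add: quotient_eigen_def vec3_linear s(1) complex_eq_iff algebra_simps)
qed

text \<open>The centre is one complex line, spanned over the reals by \<open>c\<close> and
  \<open>i c = - J c\<close>, so one nonzero eigenvector settles it.\<close>

lemma centre_eigen_all:
  assumes J: "complex_structure M5_bracket J" and c: "c \<noteq> 0" "J (vec3 1 0 0 c) = vec3 1 0 0 (- \<i> * c)"
  shows "J (vec3 1 0 0 w) = vec3 1 0 0 (- \<i> * w)"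
proof -
  have lin: "linear J" and JJ: "J (J X) = - X" for X
    using J by (auto simp: complex_structure_def)
  have I: "I_map 1 (vec3 1 0 0 c) = - J (vec3 1 0 0 c)"
    by (simp add: c(2) I_map_def vec3_linear)
  define z where "z = w / c"
  have "J (vec3 1 (z * 0) (z * 0) (z * c)) = Re z *\<^sub>R J (vec3 1 0 0 c) + Im z *\<^sub>R vec3 1 0 0 c"
    by (simp only: vec3_scale linear_add[OF lin] linear_scale[OF lin] I linear_neg[OF lin] JJ
        minus_minus)
  also have "\<dots> = vec3 1 0 0 (- \<i> * (z * c))"
    unfolding c(2) by (simp add: vec3_linear vec3_eq_iff) (simp add: complex_eq_iff algebra_simps)
  finally show ?thesis using c(1) by (simp add: z_def)
qed

text \<open>Without such an eigenvector, \<open>M = J + I\<close> is injective, hence onto, modulo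
  the centre. Its kernel then lies in the centre, so \<open>J = -I\<close> there, and integrability
  becomes \<open>[M X, M Y] = 0\<close> for all \<open>X\<close>, \<open>Y\<close>. This contradicts
  the surjectivity, as the bracket is not zero.\<close>

lemma quotient_eigenvector_exists:
  assumes J: "complex_structure M5_bracket ((*v) p)" and p: "\<not> invertible (p + matrix (I_map 1))"
  shows "\<exists>a b. (a \<noteq> 0 \<or> b \<noteq> 0) \<and> quotient_eigen (- \<i>) ((*v) p) a b"
proof (rule ccontr)
  assume "\<not> ?thesis"
  then have no: "a = 0 \<and> b = 0" if "quotient_eigen (- \<i>) ((*v) p) a b" for a b
    using that by blast
  define J where "J = (*v) p"
  have cs: "complex_structure M5_bracket J" using J by (simp add: J_def)
  have lin: "linear J" and N: "\<And>X Y. M5_bracket (J X) (J Y) - M5_bracket X Y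
      - J (M5_bracket (J X) Y) - J (M5_bracket X (J Y)) = 0"
    using cs by (auto simp: complex_structure_def)
  define M where "M X = J X + I_map 1 X" for X
  \<comment> \<open>\<open>T\<close> is \<open>M\<close> on the quotient with the central coordinate
    left unchanged, which makes bijectivity modulo the centre a statement about an endomorphism of
    the whole space.\<close>
  define T where "T X = vec3 1 (coord1 (M X)) (coord2 1 (M X)) (coord3 X)" for X
  have linM: "linear M"
    unfolding M_def[abs_def] by (rule linear_compose_add[OF lin linear_I_map])
  have linT: "linear T"
    by (intro linearI) (simp_all add: T_def linear_add[OF linM] linear_scale[OF linM] coords_linear
        vec3_linear)
  have "inj T"
  proof (subst linear_inj_iff_eq_0[OF linT], intro allI impI)
    fix X assume "T X = 0"
    then have 0: "coord1 (M X) = 0" "coord2 1 (M X) = 0" "coord3 X = 0"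
      by (simp_all add: T_def vec3_0_iff)
    then have X: "vec3 1 (coord1 X) (coord2 1 X) 0 = X"
      using vec3_coords[of 1 X] by simp
    have "quotient_eigen (- \<i>) ((*v) p) (coord1 X) (coord2 1 X)"
      using 0(1,2) unfolding quotient_eigen_def X J_def[symmetric]
      by (simp add: M_def coords_linear I_map_def eq_neg_iff_add_eq_0)
    from no[OF this] show "X = 0"
      using X vec3_0_iff[of 1 0 0 0] by simp
  qed
  then have "surj T"
    using linT by (intro linear_injective_imp_surjective) (simp_all only:)
  obtain X where X: "X \<noteq> 0" "M X = 0"
    using p by (auto simp: invertible_iff_ker matrix_vector_mult_add_rdistrib matrix_works_real[OF
        linear_I_map] M_def J_def)
  define c where "c = coord3 X"
  have "T X = vec3 1 0 0 c"
    using X(2) by (simp add: T_def c_def coord1_def coord2_def complex_eq_iff vec3_eq_iff)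
  moreover have "M (vec3 1 0 0 w) = vec3 1 0 0 (coord3 (J (vec3 1 0 0 w)) + \<i> * w)" for w
    by (subst M_def, subst complex_structure_centre[OF cs,
        of 1]) (simp_all add: I_map_def vec3_linear)
  then have "T (vec3 1 0 0 c) = vec3 1 0 0 c"
    by (simp add: T_def)
  ultimately have Xc: "X = vec3 1 0 0 c"
    using \<open>inj T\<close> by (metis injD)
  have "J (vec3 1 0 0 c) = - vec3 1 0 0 (\<i> * c)"
    using X(2) by (simp add: M_def Xc I_map_def eq_neg_iff_add_eq_0)
  then have "J (vec3 1 0 0 c) = vec3 1 0 0 (- \<i> * c)"
    by (simp add: vec3_linear)
  moreover have "c \<noteq> 0"
    using X(1) Xc by (simp add: vec3_0_iff)
  ultimately have C: "J (vec3 1 0 0 w) = vec3 1 0 0 (- \<i> * w)" for w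
    using centre_eigen_all[OF cs] by blast
  have M_bracket: "coord1 (M X) * coord2 1 (M Y) - coord1 (M Y) * coord2 1 (M X) = 0" for X Y
    using N[of X Y]
    by (simp add: M5_bracket_coords[of _ _ 1] C vec3_linear vec3_0_iff M_def I_map_def coords_linear
        algebra_simps)
  obtain X1 X2 where "T X1 = vec3 1 1 0 0" "T X2 = vec3 1 0 1 0"
    using \<open>surj T\<close> by (metis surjD)
  then show False
    using M_bracket[of X1 X2] by (simp add: T_def vec3_eq_iff)
qed

section \<open>Automorphisms from a change of basis, and the mixed case\<close>

definition basis_change :: "complex \<Rightarrow> complex \<Rightarrow> complex \<Rightarrow> complex \<Rightarrow> real^6 \<Rightarrow> real^6" where
  "basis_change v1 v2 u1 u2 X =
     vec3 1 (coord1 X * v1 + coord2 1 X * u1) (coord1 X * v2 + coord2 1 X * u2) ((v1 * u2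
         - v2 * u1) * coord3 X)"

lemma linear_basis_change: "linear (basis_change v1 v2 u1 u2)"
  by (intro linearI; simp add: basis_change_def coords_linear vec3_linear; simp add: algebra_simps)

text \<open>The bracket is a 2x2 determinant, so a linear change of the first two coordinates
  multiplies it by \<open>v1 * u2 - v2 * u1\<close>, the factor by which \<open>basis_change\<close>
  acts on the centre.\<close>

lemma bracket_basis_change:
  "M5_bracket (basis_change v1 v2 u1 u2 X) (basis_change v1 v2 u1 u2 Y) =
    basis_change v1 v2 u1 u2 (M5_bracket X Y)"
  by (simp add: M5_bracket_coords[of _ _ 1] basis_change_def vec3_eq_iff algebra_simps)

lemma linear_system_2_0:
  fixes x y :: complex
  assumes "v1 * u2 - v2 * u1 \<noteq> 0" "x * v1 + y * u1 = 0" "x * v2 + y * u2 = 0"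
  shows "x = 0 \<and> y = 0"
proof -
  have "x * (v1 * u2 - v2 * u1) = (x * v1 + y * u1) * u2 - (x * v2 + y * u2) * u1"
    "y * (v1 * u2 - v2 * u1) = (x * v2 + y * u2) * v1 - (x * v1 + y * u1) * v2"
    by (simp_all add: algebra_simps)
  then show ?thesis using assms by simp
qed

text \<open>The automorphism sending the standard basis to \<open>v\<close>, \<open>u\<close>
  conjugates \<open>p\<close> to a structure that equals \<open>I_map (-1)\<close> modulo the
  centre. Their sum is then invertible there, and \<open>C\<close> excludes a kernel in the centre,
  so the twisted chart applies.\<close>

lemma slice_chart_at_M5_mixed:
  assumes J: "complex_structure M5_bracket ((*v) p)"
    and v: "v1 \<noteq> 0 \<or> v2 \<noteq> 0" "quotient_eigen \<i> ((*v) p) v1 v2"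
    and u: "u1 \<noteq> 0 \<or> u2 \<noteq> 0" "quotient_eigen (- \<i>) ((*v) p) u1 u2"
    and C: "\<And>w. p *v vec3 1 0 0 w = vec3 1 0 0 (- \<i> * w) \<Longrightarrow> w = 0"
  shows "slice_chart_at 12 complex_structures_M5 p"
proof -
  have lin: "linear ((*v) p)"
    using J by (simp add: complex_structure_def)
  have eig: "coord1 (p *v vec3 1 (z * v1) (z * v2) 0) = \<i> * z * v1"
      "coord2 1 (p *v vec3 1 (z * v1) (z * v2) 0) = \<i> * z * v2"
    "coord1 (p *v vec3 1 (z * u1) (z * u2) 0) = - \<i> * z * u1"
      "coord2 1 (p *v vec3 1 (z * u1) (z * u2) 0) = - \<i> * z * u2" for z
    using quotient_eigen_scale[OF J _ v(2), of z] quotient_eigen_scale[OF J _ u(2), of z]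
    by (simp_all add: quotient_eigen_def)
  \<comment> \<open>If \<open>u\<close> were a multiple of \<open>v\<close>, it would satisfy the
    eigenvector equation for both i and -i, hence vanish.\<close>
  have \<Delta>: "v1 * u2 - v2 * u1 \<noteq> 0"
  proof
    assume 0: "v1 * u2 - v2 * u1 = 0"
    obtain z where z: "u1 = z * v1" "u2 = z * v2"
    proof (cases "v1 = 0")
      case True
      then show ?thesis using v(1) 0 that[of "u2 / v2"] by auto
    next
      case False
      then show ?thesis using 0 that[of "u1 / v1"] by (simp add: field_simps)
    qed
    then have "u1 = 0" "u2 = 0"
      using eig(1,2)[of z] eig(3,4)[of 1] by auto
    then show False using u(1) by simp
  qed
  define h where "h = basis_change v1 v2 u1 u2"
  define H where "H = matrix h"
  have H_works: "H *v X = h X" for X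
    by (simp add: H_def h_def matrix_works_real linear_basis_change)
  have h_mk: "h (vec3 1 a b c) = vec3 1 (a * v1 + b * u1) (a * v2 + b * u2) ((v1 * u2
      - v2 * u1) * c)" for a b c
    by (simp add: h_def basis_change_def)
  have h_inj: "X = 0" if "h X = 0" for X
  proof -
    have "coord1 X = 0 \<and> coord2 1 X = 0" "coord3 X = 0"
      using that \<Delta> linear_system_2_0[OF \<Delta>, of "coord1 X" "coord2 1 X"]
      by (auto simp: h_def basis_change_def vec3_0_iff)
    then show "X = 0"
      using vec3_coords[of 1 X] vec3_0_iff[of 1 0 0 0] by simp
  qed
  have H: "invertible H"
    using h_inj by (simp add: invertible_iff_ker H_works)
  have "X = 0" if X: "(matrix_inv H ** p ** H + matrix (I_map (-1))) *v X = 0" for X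
  proof -
    obtain a b c where abc: "X = vec3 1 a b c"
      by (rule that[OF vec3_coords[of 1 X, symmetric]]) simp
    have IX: "I_map (-1) X = vec3 1 (\<i> * a) (- \<i> * b) (\<i> * c)"
      by (simp add: I_map_def abc vec3_twist coord2_twist)
    have "H *v ((matrix_inv H ** p ** H) *v X + I_map (-1) X) = 0"
      using X by (simp add: matrix_vector_mult_add_rdistrib matrix_works_real[OF linear_I_map])
    then have 0: "p *v h X + h (I_map (-1) X) = 0"
      by (simp add: matrix_vector_right_distrib matrix_vector_mul_assoc matrix_mul_assoc
          matrix_inv_right[OF H]
          flip: H_works)
    have hX: "h X = vec3 1 (a * v1) (a * v2) 0 + vec3 1 (b * u1) (b * u2) 0 + vec3 1 0 0 ((v1 * u2
        - v2 * u1) * c)"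
      by (simp add: abc h_mk vec3_linear)
    have V: "coord1 (p *v h X) = \<i> * a * v1 - \<i> * b * u1"
        "coord2 1 (p *v h X) = \<i> * a * v2 - \<i> * b * u2"
      unfolding hX linear_add[OF lin] coords_linear eig
      by (subst complex_structure_centre[OF J, of 1]; simp)+
    have "coord1 (p *v h X) + coord1 (h (I_map (-1) X)) = 0"
        "coord2 1 (p *v h X) + coord2 1 (h (I_map (-1) X)) = 0"
      using 0 unfolding coords_linear[symmetric]
          by (simp_all add: coord1_def coord2_def complex_eq_iff)
    \<comment> \<open>The two summands agree modulo the centre, so their sum is
      \<open>2 i (a v - b u)\<close>; independence of \<open>v\<close> and \<open>u\<close> gives
      \<open>a = b = 0\<close>.\<close>
    then have "(2 * \<i> * a) * v1 + (- 2 * \<i> * b) * u1 = 0" "(2 * \<i> * a) * v2 + (- 2 * \<i> * b) * u2 = 0"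
      unfolding V by (simp_all only: IX h_mk coords_vec3) (simp_all add: algebra_simps)
    from linear_system_2_0[OF \<Delta> this] have ab: "a = 0" "b = 0" by simp_all
    have "h X = vec3 1 0 0 ((v1 * u2 - v2 * u1) * c)"
      "h (I_map (-1) X) = vec3 1 0 0 (\<i> * ((v1 * u2 - v2 * u1) * c))"
      by (simp add: abc h_mk ab) (simp add: IX h_mk ab mult.left_commute)
    then have "p *v vec3 1 0 0 ((v1 * u2 - v2 * u1) * c)
        = - vec3 1 0 0 (\<i> * ((v1 * u2 - v2 * u1) * c))"
      using 0 by (simp add: eq_neg_iff_add_eq_0)
    then have "p *v vec3 1 0 0 ((v1 * u2 - v2 * u1) * c)
        = vec3 1 0 0 (- \<i> * ((v1 * u2 - v2 * u1) * c))"
      by (simp add: vec3_linear)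
    from C[OF this] \<Delta> show "X = 0"
      by (simp add: abc ab vec3_0_iff)
  qed
  then have "invertible (matrix_inv H ** p ** H + matrix (I_map (-1)))"
    by (simp add: invertible_iff_ker)
  then have "slice_chart_at 12 complex_structures_M5 (matrix_inv H ** p ** H)"
    by (intro slice_chart_at_M5[of "-1"]) simp_all
  then show ?thesis
    by (rule slice_chart_at_M5_conj[OF H, rotated]) (simp add: H_works h_def bracket_basis_change)
qed

theorem mainTheorem11:
  "smooth_submanifold 12 complex_structures_M5"
  unfolding smooth_submanifold_iff
proof
  fix p assume p: "p \<in> complex_structures_M5"
  have J: "complex_structure M5_bracket ((*v) p)" "complex_structure M5_bracket ((*v) (- p))"
    using p uminus_complex_structures_M5[of p] by (simp_all add: complex_structures_M5_iff)
  have neg: "quotient_eigen \<sigma> ((*v) (- A)) a b" if "quotient_eigen (- \<sigma>) ((*v) A) a b" for \<sigma> A a b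
    using that by (simp add: quotient_eigen_def matrix_vector_mult_minus coord1_def coord2_def
        complex_eq_iff)
  show "slice_chart_at 12 complex_structures_M5 p"
  proof (cases "invertible (p + matrix (I_map 1)) \<or> invertible (- p + matrix (I_map 1))")
    case True
    then show ?thesis
      using slice_chart_at_M5[of 1] slice_chart_at_M5_uminus by blast
  next
    case False
    \<comment> \<open>Failure of both standard charts gives an eigenvector for -i of
      \<open>p\<close> and one of \<open>- p\<close>; the latter belongs to the eigenvalue i of
      \<open>p\<close>.\<close>
    then obtain u1 u2 v1 v2 where
      u: "u1 \<noteq> 0 \<or> u2 \<noteq> 0" "quotient_eigen (- \<i>) ((*v) p) u1 u2" and
      v: "v1 \<noteq> 0 \<or> v2 \<noteq> 0" "quotient_eigen (- \<i>) ((*v) (- p)) v1 v2"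
      using quotient_eigenvector_exists[OF J(1)] quotient_eigenvector_exists[OF J(2)] by metis
    have v': "quotient_eigen \<i> ((*v) p) v1 v2"
      using neg[of \<i> "- p"] v(2) by simp
    have u': "quotient_eigen \<i> ((*v) (- p)) u1 u2"
      using neg[of \<i> p] u(2) by simp
    show ?thesis
    proof (cases "\<exists>c. c \<noteq> 0 \<and> p *v vec3 1 0 0 c = vec3 1 0 0 (- \<i> * c)")
      case False
      then show ?thesis
        by (intro slice_chart_at_M5_mixed[OF J(1) v(1) v' u]) blast
    next
      case True
      \<comment> \<open>Here \<open>p\<close> is -i on the whole centre, so \<open>- p\<close> is i
        there. The mixed case applies to \<open>- p\<close> with the roles of \<open>u\<close> and
        \<open>v\<close> exchanged.\<close>
      then have "p *v vec3 1 0 0 w = vec3 1 0 0 (- \<i> * w)" for w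
        using centre_eigen_all[OF J(1)] by blast
      then have "w = 0" if "- p *v vec3 1 0 0 w = vec3 1 0 0 (- \<i> * w)" for w
        using that by (simp add: matrix_vector_mult_minus vec3_linear vec3_eq_iff complex_eq_iff)
      then have "slice_chart_at 12 complex_structures_M5 (- p)"
        by (rule slice_chart_at_M5_mixed[OF J(2) u(1) u' v])
      then show ?thesis
        by (rule slice_chart_at_M5_uminus)
    qed
  qed
qed

end
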